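(* Let $\lambda_1,\lambda_2,\lambda_3,\lambda_4\in\mathbb R$, and let $G$ be a connected 4-dimensional Lie group whose Lie algebra has a basis of left-invariant vector fields $\{X_1,X_2,X_3,X_4\}$ with $$\begin{array}{ll}[X_1,X_3]=\lambda_2X_2+\lambda_4X_4,&[X_2,X_4]=\lambda_1X_1+\lambda_3X_3,\\ {}[X_2,X_3]=-\lambda_2X_1-\lambda_3X_4,&[X_3,X_4]=-\lambda_4X_1+\lambda_3X_2,\\ {}[X_4,X_1]=\lambda_1X_2+\lambda_4X_3,&[X_2,X_1]=-\lambda_2X_3+\lambda_1X_4.\end{array}$$ Let $J$ be the left-invariant almost complex structure with $JX_1=X_3$, $JX_2=X_4$, $JX_3=-X_1$, $JX_4=-X_2$, let $g$ be the left-invariant metric with $g(X_1,X_1)=g(X_2,X_2)=-g(X_3,X_3)=-g(X_4,X_4)=1$ and $g(X_i,X_j)=0$ for $i\ne j$, and let $\tilde g(X,Y)=g(X,JY)$. Then the following conditions are equivalent for the manifold $(G,J,\tilde g)$: (i) $(G,J,\tilde g)$ is an isotropic Kähler manifold with Norden metric; (ii) the Weyl tensor $\tilde W$ of $\tilde g$ vanishes; (iii) $\lambda_1\lambda_3+\lambda_2\lambda_4=0$; (iv) the scalar curvature $\tilde\tau$ of $\tilde g$ vanishes.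
   Context: A Norden metric on an almost complex manifold $(M,J)$ (with $J^2=-\mathrm{id}$) is a pseudo-Riemannian metric $h$ such that $h(JX,JY)=-h(X,Y)$ for all vector fields $X,Y$; $g$ and $\tilde g$ are both Norden metrics on $(G,J)$. Let $\tilde\nabla$ be the Levi-Civita connection of $\tilde g$, and let $\tilde g^{ij}$ be the entries of the inverse of the matrix $(\tilde g(e_i,e_j))$ in a basis $\{e_i\}$ of a tangent space. The square norm of $\tilde\nabla J$ with respect to $\tilde g$ is $$\|\tilde\nabla J\|^2=\tilde g^{ij}\tilde g^{kl}\,\tilde g\bigl((\tilde\nabla_{e_i}J)e_k,(\tilde\nabla_{e_j}J)e_l\bigr)$$ (summation over repeated indices). The manifold $(G,J,\tilde g)$ is called an isotropic Kähler manifold with Norden metric if $\|\tilde\nabla J\|^2=0$. Curvature conventions: $\tilde R(X,Y)Z=\tilde\nabla_X\tilde\nabla_YZ-\tilde\nabla_Y\tilde\nabla_XZ-\tilde\nabla_{[X,Y]}Z$, $\tilde R(X,Y,Z,U)=\tilde g(\tilde R(X,Y)Z,U)$, $\tilde\rho(y,z)=\tilde g^{ij}\tilde R(e_i,y,z,e_j)$, $\tilde\tau=\tilde g^{ij}\tilde\rho(e_i,e_j)$. The Weyl tensor in dimension $4$ is $$\tilde W=\tilde R-\tfrac12\Bigl(\tilde\psi_1(\tilde\rho)-\tfrac{\tilde\tau}{3}\tilde\pi_1\Bigr),$$ where $\tilde\psi_1(\tilde\rho)(x,y,z,u)=\tilde g(y,z)\tilde\rho(x,u)-\tilde g(x,z)\tilde\rho(y,u)+\tilde\rho(y,z)\tilde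 g(x,u)-\tilde\rho(x,z)\tilde g(y,u)$ and $\tilde\pi_1(x,y,z,u)=\tilde g(y,z)\tilde g(x,u)-\tilde g(x,z)\tilde g(y,u)$. *)

theory Defs
  imports "HOL-Analysis.Analysis" "HOL-Algebra.Group"
begin

section \<open>Smooth manifolds\<close>

text \<open>Only meant for open \<open>S\<close>. Quantifying over all directions \<open>v\<close> covers all partial
  derivatives.\<close>

primrec Ck_on :: "nat \<Rightarrow> 'e::euclidean_space set \<Rightarrow> ('e \<Rightarrow> 'f::real_normed_vector) \<Rightarrow> bool" where
  "Ck_on 0 S f \<longleftrightarrow> continuous_on S f"
| "Ck_on (Suc k) S f \<longleftrightarrow>
     f differentiable_on S \<and> (\<forall>v. Ck_on k S (\<lambda>x. frechet_derivative f (at x) v))"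

definition smooth_on :: "'e::euclidean_space set \<Rightarrow> ('e \<Rightarrow> 'f::real_normed_vector) \<Rightarrow> bool" where
  "smooth_on S f \<longleftrightarrow> (\<forall>k. Ck_on k S f)"

text \<open>The underlying set of a manifold is a whole type; a chart \<open>(U, \<phi>)\<close> is a domain together
  with a map that only matters on that domain.\<close>

type_synonym ('a, 'e) chart = "'a set \<times> ('a \<Rightarrow> 'e)"

definition is_chart :: "('a::topological_space, 'e::euclidean_space) chart \<Rightarrow> bool" where
  "is_chart c \<longleftrightarrow> (case c of (U, \<phi>) \<Rightarrow>
     open U \<and> open (\<phi> ` U) \<and> homeomorphism U (\<phi> ` U) \<phi> (inv_into U \<phi>))"

text \<open>Hausdorff and second countable are required through the type classes. The atlas need not be
  maximal.\<close>

definition smooth_manifold ::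
  "('a::{t2_space, second_countable_topology}, 'e::euclidean_space) chart set \<Rightarrow> bool" where
  "smooth_manifold A \<longleftrightarrow>
     (\<forall>c\<in>A. is_chart c) \<and> (\<Union>(U, \<phi>)\<in>A. U) = UNIV \<and>
     (\<forall>(U, \<phi>)\<in>A. \<forall>(V, \<psi>)\<in>A. smooth_on (\<phi> ` (U \<inter> V)) (\<psi> \<circ> inv_into U \<phi>))"

definition smooth_fun :: "('a, 'e::euclidean_space) chart set \<Rightarrow> ('a \<Rightarrow> real) \<Rightarrow> bool" where
  "smooth_fun A f \<longleftrightarrow> (\<forall>(U, \<phi>)\<in>A. smooth_on (\<phi> ` U) (f \<circ> inv_into U \<phi>))"

definition smooth_map ::
  "('a::topological_space, 'e::euclidean_space) chart set \<Rightarrow>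
   ('b::topological_space, 'f::euclidean_space) chart set \<Rightarrow> ('a \<Rightarrow> 'b) \<Rightarrow> bool" where
  "smooth_map A B F \<longleftrightarrow> continuous_on UNIV F \<and>
     (\<forall>(U, \<phi>)\<in>A. \<forall>(V, \<psi>)\<in>B. smooth_on (\<phi> ` (U \<inter> F -` V)) (\<psi> \<circ> F \<circ> inv_into U \<phi>))"

definition prod_atlas ::
  "('a, 'e) chart set \<Rightarrow> ('b, 'f) chart set \<Rightarrow> ('a \<times> 'b, 'e \<times> 'f) chart set" where
  "prod_atlas A B = (\<lambda>((U, \<phi>), (V, \<psi>)). (U \<times> V, map_prod \<phi> \<psi>)) ` (A \<times> B)"

section \<open>Tangent vectors and vector fields\<close>

text \<open>A tangent vector is represented by its action on smooth functions, i.e. as a directional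
  derivative in some chart. Functionals are set to 0 on non-smooth functions, so that equality of
  tangent vectors is equality of functions; linear combinations are taken pointwise.\<close>

type_synonym 'a tvec = "('a \<Rightarrow> real) \<Rightarrow> real"
type_synonym 'a vfield = "'a \<Rightarrow> 'a tvec"

definition tangent_space :: "('a, 'e::euclidean_space) chart set \<Rightarrow> 'a \<Rightarrow> 'a tvec set" where
  "tangent_space A p = {v. \<exists>(U, \<phi>)\<in>A. p \<in> U \<and> (\<exists>w. v = (\<lambda>f.
     if smooth_fun A f then frechet_derivative (f \<circ> inv_into U \<phi>) (at (\<phi> p)) w else 0))}"

definition vector_field :: "('a, 'e::euclidean_space) chart set \<Rightarrow> 'a vfield \<Rightarrow> bool" where
  "vector_field A X \<longleftrightarrow> (\<forall>p. X p \<in> tangent_space A p) \<and>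
     (\<forall>f. smooth_fun A f \<longrightarrow> smooth_fun A (\<lambda>p. X p f))"

definition bracket :: "'a vfield \<Rightarrow> 'a vfield \<Rightarrow> 'a vfield" where
  "bracket X Y = (\<lambda>p f. X p (\<lambda>q. Y q f) - Y p (\<lambda>q. X q f))"

definition differential :: "('b, 'f::euclidean_space) chart set \<Rightarrow> ('a \<Rightarrow> 'b) \<Rightarrow> 'a tvec \<Rightarrow> 'b tvec"
  where "differential B F v = (\<lambda>f. if smooth_fun B f then v (f \<circ> F) else 0)"

definition tangent_basis ::
  "('a, 'e::euclidean_space) chart set \<Rightarrow> 'a \<Rightarrow> ('n::finite \<Rightarrow> 'a tvec) \<Rightarrow> bool" where
  "tangent_basis A p e \<longleftrightarrow> (\<forall>i. e i \<in> tangent_space A p) \<and>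
     (\<forall>v\<in>tangent_space A p. \<exists>!c::real^'n. v = (\<lambda>f. \<Sum>i\<in>UNIV. c $ i * e i f))"

section \<open>Lie groups and left-invariant objects\<close>

definition lie_group ::
  "('a::{t2_space, second_countable_topology}, 'e::euclidean_space) chart set \<Rightarrow> 'a monoid \<Rightarrow> bool"
  where
  "lie_group A G \<longleftrightarrow> smooth_manifold A \<and> group G \<and> carrier G = UNIV \<and>
     smooth_map (prod_atlas A A) A (\<lambda>(a, b). a \<otimes>\<^bsub>G\<^esub> b) \<and>
     smooth_map A A (\<lambda>a. inv\<^bsub>G\<^esub> a)"

definition left_trans :: "'a monoid \<Rightarrow> 'a \<Rightarrow> 'a \<Rightarrow> 'a" where
  "left_trans G a b = a \<otimes>\<^bsub>G\<^esub> b"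

definition left_inv_fields :: "('a, 'e::euclidean_space) chart set \<Rightarrow> 'a monoid \<Rightarrow> 'a vfield set" where
  "left_inv_fields A G = {X. vector_field A X \<and>
     (\<forall>a p. X (left_trans G a p) = differential A (left_trans G a) (X p))}"

definition lie_algebra_basis ::
  "('a, 'e::euclidean_space) chart set \<Rightarrow> 'a monoid \<Rightarrow> ('n::finite \<Rightarrow> 'a vfield) \<Rightarrow> bool" where
  "lie_algebra_basis A G X \<longleftrightarrow> (\<forall>i. X i \<in> left_inv_fields A G) \<and>
     (\<forall>Y\<in>left_inv_fields A G. \<exists>!c::real^'n. Y = (\<lambda>p f. \<Sum>i\<in>UNIV. c $ i * X i p f))"

section \<open>Almost complex structures and metrics\<close>

text \<open>Tensor fields are families of maps on tangent vectors; values off the tangent spaces are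
  irrelevant.\<close>

type_synonym 'a endo_field = "'a \<Rightarrow> 'a tvec \<Rightarrow> 'a tvec"
type_synonym 'a form_field = "'a \<Rightarrow> 'a tvec \<Rightarrow> 'a tvec \<Rightarrow> real"

definition almost_complex :: "('a, 'e::euclidean_space) chart set \<Rightarrow> 'a endo_field \<Rightarrow> bool" where
  "almost_complex A J \<longleftrightarrow>
     (\<forall>p. \<forall>v\<in>tangent_space A p. J p v \<in> tangent_space A p \<and> J p (J p v) = (\<lambda>f. - v f)) \<and>
     (\<forall>p. \<forall>v\<in>tangent_space A p. \<forall>w\<in>tangent_space A p. \<forall>a b.
        J p (\<lambda>f. a * v f + b * w f) = (\<lambda>f. a * J p v f + b * J p w f)) \<and>
     (\<forall>X. vector_field A X \<longrightarrow> vector_field A (\<lambda>p. J p (X p)))"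

text \<open>The signature is locally constant by nondegeneracy and continuity, hence constant on a
  connected manifold.\<close>

definition pseudo_riemannian :: "('a, 'e::euclidean_space) chart set \<Rightarrow> 'a form_field \<Rightarrow> bool" where
  "pseudo_riemannian A h \<longleftrightarrow>
     (\<forall>p. \<forall>u\<in>tangent_space A p. \<forall>v\<in>tangent_space A p. h p u v = h p v u) \<and>
     (\<forall>p. \<forall>u\<in>tangent_space A p. \<forall>v\<in>tangent_space A p. \<forall>w\<in>tangent_space A p. \<forall>a b.
        h p (\<lambda>f. a * v f + b * w f) u = a * h p v u + b * h p w u) \<and>
     (\<forall>p. \<forall>u\<in>tangent_space A p. (\<forall>v\<in>tangent_space A p. h p u v = 0) \<longrightarrow> u = (\<lambda>f. 0)) \<and>
     (\<forall>X Y. vector_field A X \<longrightarrow> vector_field A Y \<longrightarrow> smooth_fun A (\<lambda>p. h p (X p) (Y p)))"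

definition norden_metric ::
  "('a, 'e::euclidean_space) chart set \<Rightarrow> 'a endo_field \<Rightarrow> 'a form_field \<Rightarrow> bool" where
  "norden_metric A J h \<longleftrightarrow> almost_complex A J \<and> pseudo_riemannian A h \<and>
     (\<forall>p. \<forall>v\<in>tangent_space A p. \<forall>w\<in>tangent_space A p. h p (J p v) (J p w) = - h p v w)"

definition associated_metric :: "'a endo_field \<Rightarrow> 'a form_field \<Rightarrow> 'a form_field" where
  "associated_metric J g = (\<lambda>p v w. g p v (J p w))"

definition left_inv_endo ::
  "('a, 'e::euclidean_space) chart set \<Rightarrow> 'a monoid \<Rightarrow> 'a endo_field \<Rightarrow> bool" where
  "left_inv_endo A G J \<longleftrightarrow> (\<forall>a p. \<forall>v\<in>tangent_space A p.
     J (left_trans G a p) (differential A (left_trans G a) v)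
       = differential A (left_trans G a) (J p v))"

definition left_inv_form ::
  "('a, 'e::euclidean_space) chart set \<Rightarrow> 'a monoid \<Rightarrow> 'a form_field \<Rightarrow> bool" where
  "left_inv_form A G h \<longleftrightarrow> (\<forall>a p. \<forall>v\<in>tangent_space A p. \<forall>w\<in>tangent_space A p.
     h (left_trans G a p) (differential A (left_trans G a) v) (differential A (left_trans G a) w)
       = h p v w)"

section \<open>Levi-Civita connection\<close>

type_synonym 'a connection = "'a vfield \<Rightarrow> 'a vfield \<Rightarrow> 'a vfield"

definition affine_connection ::
  "('a, 'e::euclidean_space) chart set \<Rightarrow> 'a connection \<Rightarrow> bool" where
  "affine_connection A nabla \<longleftrightarrow> (\<forall>X Y Z. vector_field A X \<longrightarrow> vector_field A Y \<longrightarrow> vector_field A Z \<longrightarrow>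
     vector_field A (nabla X Y) \<and>
     nabla (\<lambda>p f. X p f + Y p f) Z = (\<lambda>p f. nabla X Z p f + nabla Y Z p f) \<and>
     nabla X (\<lambda>p f. Y p f + Z p f) = (\<lambda>p f. nabla X Y p f + nabla X Z p f) \<and>
     (\<forall>s. smooth_fun A s \<longrightarrow>
        nabla (\<lambda>p f. s p * X p f) Y = (\<lambda>p f. s p * nabla X Y p f) \<and>
        nabla X (\<lambda>p f. s p * Y p f) = (\<lambda>p f. X p s * Y p f + s p * nabla X Y p f)))"

definition levi_civita ::
  "('a, 'e::euclidean_space) chart set \<Rightarrow> 'a form_field \<Rightarrow> 'a connection \<Rightarrow> bool" where
  "levi_civita A h nabla \<longleftrightarrow> affine_connection A nabla \<and>
     (\<forall>X Y. vector_field A X \<longrightarrow> vector_field A Y \<longrightarrow>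
        (\<lambda>p f. nabla X Y p f - nabla Y X p f) = bracket X Y) \<and>
     (\<forall>X Y Z p. vector_field A X \<longrightarrow> vector_field A Y \<longrightarrow> vector_field A Z \<longrightarrow>
        X p (\<lambda>q. h q (Y q) (Z q)) = h p (nabla X Y p) (Z p) + h p (Y p) (nabla X Z p))"

section \<open>Tensors at a point\<close>

text \<open>A tensorial expression in vector fields is evaluated on tangent vectors at \<open>p\<close> through
  arbitrary extensions to vector fields.\<close>

definition extend :: "('a, 'e::euclidean_space) chart set \<Rightarrow> 'a \<Rightarrow> 'a tvec \<Rightarrow> 'a vfield" where
  "extend A p v = (SOME X. vector_field A X \<and> X p = v)"

text \<open>\<open>contract A h p B\<close> is \<open>h\<^sup>i\<^sup>j B(e\<^sub>i, e\<^sub>j)\<close> for a basis \<open>e\<close> of the tangent space at \<open>p\<close>;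
  it is independent of the basis for bilinear \<open>B\<close>.\<close>

definition contract ::
  "('a, real^'n::finite) chart set \<Rightarrow> 'a form_field \<Rightarrow> 'a \<Rightarrow> ('a tvec \<Rightarrow> 'a tvec \<Rightarrow> real) \<Rightarrow> real" where
  "contract A h p B = (let e = (SOME e :: 'n \<Rightarrow> 'a tvec. tangent_basis A p e);
       hinv = matrix_inv (\<chi> i j. h p (e i) (e j)) :: real^'n^'n
     in \<Sum>i\<in>UNIV. \<Sum>j\<in>UNIV. hinv $ i $ j * B (e i) (e j))"

definition nabla_J :: "'a connection \<Rightarrow> 'a endo_field \<Rightarrow> 'a vfield \<Rightarrow> 'a vfield \<Rightarrow> 'a vfield" where
  "nabla_J nabla J X Y =
     (\<lambda>p f. nabla X (\<lambda>q. J q (Y q)) p f - J p (nabla X Y p) f)"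

definition nabla_J_at ::
  "('a, 'e::euclidean_space) chart set \<Rightarrow> 'a connection \<Rightarrow> 'a endo_field \<Rightarrow> 'a \<Rightarrow>
   'a tvec \<Rightarrow> 'a tvec \<Rightarrow> 'a tvec" where
  "nabla_J_at A nabla J p x y = nabla_J nabla J (extend A p x) (extend A p y) p"

definition square_norm_nabla_J ::
  "('a, real^'n::finite) chart set \<Rightarrow> 'a connection \<Rightarrow> 'a endo_field \<Rightarrow> 'a form_field \<Rightarrow> 'a \<Rightarrow> real"
  where
  "square_norm_nabla_J A nabla J h p =
     contract A h p (\<lambda>ei ej. contract A h p (\<lambda>ek el.
       h p (nabla_J_at A nabla J p ei ek) (nabla_J_at A nabla J p ej el)))"

definition isotropic_kaehler_norden ::
  "('a, real^'n::finite) chart set \<Rightarrow> 'a connection \<Rightarrow> 'a endo_field \<Rightarrow> 'a form_field \<Rightarrow> bool" where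
  "isotropic_kaehler_norden A nabla J h \<longleftrightarrow>
     norden_metric A J h \<and> (\<forall>p. square_norm_nabla_J A nabla J h p = 0)"

section \<open>Curvature\<close>

definition curv :: "'a connection \<Rightarrow> 'a vfield \<Rightarrow> 'a vfield \<Rightarrow> 'a vfield \<Rightarrow> 'a vfield" where
  "curv nabla X Y Z = (\<lambda>p f. nabla X (nabla Y Z) p f - nabla Y (nabla X Z) p f
     - nabla (bracket X Y) Z p f)"

definition curv_at ::
  "('a, 'e::euclidean_space) chart set \<Rightarrow> 'a connection \<Rightarrow> 'a form_field \<Rightarrow> 'a \<Rightarrow>
   'a tvec \<Rightarrow> 'a tvec \<Rightarrow> 'a tvec \<Rightarrow> 'a tvec \<Rightarrow> real" where
  "curv_at A nabla h p x y z u =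
     h p (curv nabla (extend A p x) (extend A p y) (extend A p z) p) u"

definition ricci ::
  "('a, real^'n::finite) chart set \<Rightarrow> 'a connection \<Rightarrow> 'a form_field \<Rightarrow> 'a form_field" where
  "ricci A nabla h p y z = contract A h p (\<lambda>ei ej. curv_at A nabla h p ei y z ej)"

definition scalar_curvature ::
  "('a, real^'n::finite) chart set \<Rightarrow> 'a connection \<Rightarrow> 'a form_field \<Rightarrow> 'a \<Rightarrow> real" where
  "scalar_curvature A nabla h p = contract A h p (ricci A nabla h p)"

definition psi1 :: "'a form_field \<Rightarrow> 'a form_field \<Rightarrow> 'a \<Rightarrow>
    'a tvec \<Rightarrow> 'a tvec \<Rightarrow> 'a tvec \<Rightarrow> 'a tvec \<Rightarrow> real" where
  "psi1 h S p x y z u =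
     h p y z * S p x u - h p x z * S p y u + S p y z * h p x u - S p x z * h p y u"

definition pi1 :: "'a form_field \<Rightarrow> 'a \<Rightarrow> 'a tvec \<Rightarrow> 'a tvec \<Rightarrow> 'a tvec \<Rightarrow> 'a tvec \<Rightarrow> real" where
  "pi1 h p x y z u = h p y z * h p x u - h p x z * h p y u"

text \<open>The coefficients are those of dimension 4.\<close>

definition weyl :: "('a, real^4) chart set \<Rightarrow> 'a connection \<Rightarrow> 'a form_field \<Rightarrow> 'a \<Rightarrow>
    'a tvec \<Rightarrow> 'a tvec \<Rightarrow> 'a tvec \<Rightarrow> 'a tvec \<Rightarrow> real" where
  "weyl A nabla h p x y z u = curv_at A nabla h p x y z u
     - 1/2 * (psi1 h (ricci A nabla h) p x y z u
              - scalar_curvature A nabla h p / 3 * pi1 h p x y z u)"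

end

theory Submission
  imports Defs
begin

text \<open>Pairing with the metric shows that the left-invariant fields
  \<open>X\<^sub>1, \<dots>, X\<^sub>4\<close> are independent at every point, hence form a global frame. Koszul's formula
  turns their brackets into constant Christoffel symbols, and tensoriality reduces the curvature and
  \<open>\<nabla>J\<close> at arbitrary tangent vectors to these constants. With
  \<open>K = \<lambda>\<^sub>1\<lambda>\<^sub>3 + \<lambda>\<^sub>2\<lambda>\<^sub>4\<close> one finds the scalar curvature \<open>-5K\<close>, the square norm
  \<open>-8K\<close>, and a Weyl tensor all of whose components are constant multiples of \<open>K\<close>.\<close>

section \<open>Smooth functions and tangent vectors\<close>

text \<open>Tangent vectors are functionals on globally smooth functions, and a connection acts on
  global fields only, so passing from a field to its value at a point is the delicate matter
  throughout. The place usually taken by cutoff functions is taken by the frame: every vector field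
  is a combination of its members with globally smooth coefficients, and every tangent vector
  extends with constant ones. A chart exhibits each tangent space as a linear image of the model
  space, which bounds its dimension; independence of the frame supplies the other half of the count.
  In the frame the matrix of \<open>gt\<close> is minus the permutation matrix exchanging 1 with 3
  and 2 with 4. It is its own inverse, so lowering, raising or contracting costs a sign and a
  permutation, and the component tables stay small.\<close>

lemma Ck_on_cong:
  assumes "open S" "\<And>x. x \<in> S \<Longrightarrow> f x = g x" "Ck_on k S f"
  shows "Ck_on k S g"
  using assms(2,3)
proof (induction k arbitrary: f g)
  case 0
  then show ?case using continuous_on_cong[of S S f g] by simp
next
  case (Suc k)
  \<comment> \<open>Openness of \<open>S\<close> makes \<open>f\<close> and \<open>g\<close> agree
    on a neighbourhood of \<open>x\<close>, so they have the same derivatives there.\<close>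
  have D: "(f has_derivative D) (at x) \<longleftrightarrow> (g has_derivative D) (at x)" if "x \<in> S" for x D
    using has_derivative_transform_within_open[OF _ \<open>open S\<close> that, of f D UNIV g]
      has_derivative_transform_within_open[OF _ \<open>open S\<close> that, of g D UNIV f] Suc.prems(1) by auto
  then have F: "frechet_derivative f (at x) = frechet_derivative g (at x)" if "x \<in> S" for x
    using that by (simp add: frechet_derivative_def)
  have "g differentiable_on S"
    using Suc.prems(2) D \<open>open S\<close>
    by (auto simp: differentiable_on_eq_differentiable_at differentiable_def)
  moreover have "Ck_on k S (\<lambda>x. frechet_derivative g (at x) v)" for v
    using Suc.IH[of "\<lambda>x. frechet_derivative f (at x) v" "\<lambda>x. frechet_derivative g (at x) v"]
      Suc.prems(2) F by auto
  ultimately show ?case by simp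
qed

text \<open>Serves the Leibniz rule: the undifferentiated factor of a product has order
  \<open>Suc k\<close>, while the induction hypothesis asks for order \<open>k\<close>.\<close>

lemma Ck_on_SucD: "Ck_on (Suc k) S f \<Longrightarrow> Ck_on k S f"
proof (induction k arbitrary: f)
  case 0
  then show ?case by (simp add: differentiable_imp_continuous_on)
qed auto

lemma Ck_on_const: "Ck_on k S (\<lambda>x. c)"
  by (induction k arbitrary: c) (simp_all add: frechet_derivative_const)

lemma Ck_on_add:
  assumes "open S" "Ck_on k S f" "Ck_on k S g"
  shows "Ck_on k S (\<lambda>x. f x + g x)"
  using assms(2,3)
proof (induction k arbitrary: f g)
  case 0
  then show ?case by (simp add: continuous_on_add)
next
  case (Suc k)
  have F: "frechet_derivative (\<lambda>x. f x + g x) (at x) v =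
      frechet_derivative f (at x) v + frechet_derivative g (at x) v" if "x \<in> S" for x v
    using Suc.prems that \<open>open S\<close>
    by (intro frechet_derivative_at[THEN fun_cong, symmetric] has_derivative_add)
       (auto simp: differentiable_on_eq_differentiable_at frechet_derivative_works[symmetric])
  have "Ck_on k S (\<lambda>x. frechet_derivative (\<lambda>x. f x + g x) (at x) v)" for v
    by (rule Ck_on_cong[OF \<open>open S\<close> _ Suc.IH]) (use Suc.prems F in auto)
  then show ?case using Suc.prems by simp
qed

lemma Ck_on_mult:
  fixes f g :: "'e::euclidean_space \<Rightarrow> real"
  assumes "open S" "Ck_on k S f" "Ck_on k S g"
  shows "Ck_on k S (\<lambda>x. f x * g x)"
  using assms(2,3)
proof (induction k arbitrary: f g)
  case 0
  then show ?case by (simp add: continuous_on_mult)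
next
  case (Suc k)
  have F: "frechet_derivative (\<lambda>x. f x * g x) (at x) v =
      f x * frechet_derivative g (at x) v + frechet_derivative f (at x) v * g x"
    if "x \<in> S" for x v
  proof -
    have "(f has_derivative frechet_derivative f (at x)) (at x)"
         "(g has_derivative frechet_derivative g (at x)) (at x)"
      using Suc.prems that \<open>open S\<close>
      by (auto simp: differentiable_on_eq_differentiable_at frechet_derivative_works[symmetric])
    then show ?thesis
      by (rule frechet_derivative_at[OF has_derivative_mult, THEN fun_cong, symmetric])
  qed
  have "Ck_on k S (\<lambda>x. frechet_derivative (\<lambda>x. f x * g x) (at x) v)" for v
  proof -
    have "Ck_on k S (\<lambda>x. f x * frechet_derivative g (at x) v + frechet_derivative f (at x) v * g x)"
      using Suc.prems Suc.prems[THEN Ck_on_SucD] by (intro Ck_on_add[OF \<open>open S\<close>] Suc.IH) auto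
    then show ?thesis by (rule Ck_on_cong[OF \<open>open S\<close>, rotated]) (simp add: F)
  qed
  moreover have "(\<lambda>x. f x * g x) differentiable_on S"
    using Suc.prems \<open>open S\<close> by (auto simp: differentiable_on_eq_differentiable_at)
  ultimately show ?case by simp
qed

section \<open>Tangent vectors seen through a chart\<close>

definition chart_vector ::
  "('a, 'e::euclidean_space) chart set \<Rightarrow> 'a set \<Rightarrow> ('a \<Rightarrow> 'e) \<Rightarrow> 'a \<Rightarrow> 'e \<Rightarrow> 'a tvec" where
  "chart_vector A U \<phi> p w = (\<lambda>f.
     if smooth_fun A f then frechet_derivative (f \<circ> inv_into U \<phi>) (at (\<phi> p)) w else 0)"

locale smooth_mfd =
  fixes A :: "('a::{t2_space, second_countable_topology}, 'e::euclidean_space) chart set"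
  assumes smooth_manifold: "smooth_manifold A"
begin

lemma chart:
  assumes "(U, \<phi>) \<in> A"
  shows "open U" "open (\<phi> ` U)" "homeomorphism U (\<phi> ` U) \<phi> (inv_into U \<phi>)" "inj_on \<phi> U"
proof -
  show "open U" "open (\<phi> ` U)" "homeomorphism U (\<phi> ` U) \<phi> (inv_into U \<phi>)"
    using smooth_manifold assms by (auto simp: smooth_manifold_def is_chart_def)
  then show "inj_on \<phi> U"
    by (metis homeomorphism_def inj_on_inverseI)
qed

lemma chart_exists: obtains U \<phi> where "(U, \<phi>) \<in> A" "p \<in> U"
proof -
  have "p \<in> (\<Union>(U, \<phi>)\<in>A. U)"
    using smooth_manifold unfolding smooth_manifold_def by blast
  then show ?thesis using that by blast
qed

lemma smooth_fun_const: "smooth_fun A (\<lambda>p. c)"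
  by (auto simp: smooth_fun_def smooth_on_def o_def Ck_on_const)

lemma smooth_fun_iff:
  "smooth_fun A f \<longleftrightarrow> (\<forall>U \<phi> k. (U, \<phi>) \<in> A \<longrightarrow> Ck_on k (\<phi> ` U) (\<lambda>x. f (inv_into U \<phi> x)))"
  unfolding smooth_fun_def smooth_on_def o_def by blast

lemma smooth_fun_add: "smooth_fun A f \<Longrightarrow> smooth_fun A g \<Longrightarrow> smooth_fun A (\<lambda>p. f p + g p)"
  unfolding smooth_fun_iff by (intro allI impI Ck_on_add chart(2)) simp_all

lemma smooth_fun_mult: "smooth_fun A f \<Longrightarrow> smooth_fun A g \<Longrightarrow> smooth_fun A (\<lambda>p. f p * g p)"
  unfolding smooth_fun_iff by (intro allI impI Ck_on_mult chart(2)) simp_all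

lemma smooth_fun_sum:
  "(\<And>i. i \<in> I \<Longrightarrow> smooth_fun A (s i)) \<Longrightarrow> smooth_fun A (\<lambda>p. \<Sum>i\<in>I. s i p)"
  by (induction I rule: infinite_finite_induct) (simp_all add: smooth_fun_const smooth_fun_add)

lemma smooth_fun_differentiable:
  assumes "smooth_fun A f" "(U, \<phi>) \<in> A" "p \<in> U"
  shows "(f \<circ> inv_into U \<phi>) differentiable (at (\<phi> p))"
proof -
  have "Ck_on (Suc 0) (\<phi> ` U) (f \<circ> inv_into U \<phi>)"
    using assms by (auto simp: smooth_fun_def smooth_on_def simp del: Ck_on.simps)
  then show ?thesis
    using assms chart(2)[OF assms(2)] by (auto simp: differentiable_on_eq_differentiable_at)
qed

lemma chart_vector_linear:
  assumes "(U, \<phi>) \<in> A" "p \<in> U"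
  shows "linear (\<lambda>w. chart_vector A U \<phi> p w f)"
  using linear_frechet_derivative[OF smooth_fun_differentiable[OF _ assms]]
  by (cases "smooth_fun A f") (auto simp: chart_vector_def linear_iff)

text \<open>Chain rule along the transition map: \<open>w'\<close> is the derivative of that map at
  \<open>\<phi> p\<close> applied to \<open>w\<close>. It does not depend on the test function, so
  the two functionals coincide.\<close>

lemma chart_vector_change:
  assumes U: "(U, \<phi>) \<in> A" "p \<in> U" and V: "(V, \<psi>) \<in> A" "p \<in> V"
  shows "\<exists>w'. chart_vector A U \<phi> p w = chart_vector A V \<psi> p w'"
proof -
  let ?t = "\<psi> \<circ> inv_into U \<phi>" and ?S = "\<phi> ` (U \<inter> V)"
  have op: "open ?S"
    using homeomorphism_imp_open_map[OF chart(3)[OF U(1)], of "U \<inter> V"] chart[OF U(1)] chart[OF V(1)]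
    by (metis inf_le1 open_Int open_openin_trans openin_open_eq open_subset)
  have "Ck_on (Suc 0) ?S ?t"
    using smooth_manifold U V by (fastforce simp: smooth_manifold_def smooth_on_def simp del: Ck_on.simps)
  then have dt: "?t differentiable (at (\<phi> p))"
    using op U V by (auto simp: differentiable_on_eq_differentiable_at)
  have inv: "inv_into U \<phi> (\<phi> p) = p"
    using chart(4)[OF U(1)] U by simp
  have "frechet_derivative (f \<circ> inv_into U \<phi>) (at (\<phi> p)) w =
      frechet_derivative (f \<circ> inv_into V \<psi>) (at (\<psi> p)) (frechet_derivative ?t (at (\<phi> p)) w)"
    if "smooth_fun A f" for f
  proof -
    have "(f \<circ> inv_into V \<psi>) differentiable (at (?t (\<phi> p)))"
      using smooth_fun_differentiable[OF that V] inv by simp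
    then have "((f \<circ> inv_into V \<psi>) \<circ> ?t has_derivative
        frechet_derivative (f \<circ> inv_into V \<psi>) (at (\<psi> p)) \<circ> frechet_derivative ?t (at (\<phi> p))) (at (\<phi> p))"
      using dt inv diff_chain_at[of ?t _ "\<phi> p"] by (simp add: frechet_derivative_works)
    \<comment> \<open>The two functions agree only over the overlap of the charts; the derivative at
      \<open>\<phi> p\<close> carries over because the image of the overlap is open.\<close>
    moreover have "((f \<circ> inv_into V \<psi>) \<circ> ?t) y = (f \<circ> inv_into U \<phi>) y" if "y \<in> ?S" for y
      using that chart(4)[OF U(1)] chart(4)[OF V(1)] by auto
    ultimately have "(f \<circ> inv_into U \<phi> has_derivative
        frechet_derivative (f \<circ> inv_into V \<psi>) (at (\<psi> p)) \<circ> frechet_derivative ?t (at (\<phi> p))) (at (\<phi> p))"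
      using has_derivative_transform_within_open[OF _ op] U V by blast
    from frechet_derivative_at[OF this] show ?thesis by (metis comp_apply)
  qed
  then show ?thesis unfolding chart_vector_def by (intro exI ext) auto
qed

text \<open>The definition lets the chart vary from vector to vector. Fixing one chart brings all
  tangent vectors at \<open>p\<close> into one model space, where they can be added.\<close>

lemma tangent_space_eq_range:
  assumes "(U, \<phi>) \<in> A" "p \<in> U"
  shows "tangent_space A p = range (chart_vector A U \<phi> p)"
proof -
  have "tangent_space A p = {v. \<exists>(V, \<psi>)\<in>A. p \<in> V \<and> (\<exists>w. v = chart_vector A V \<psi> p w)}"
    by (simp add: tangent_space_def chart_vector_def)
  also have "\<dots> = range (chart_vector A U \<phi> p)"
    using assms chart_vector_change by (auto simp: image_iff)
  finally show ?thesis .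
qed

lemma tangent_space_lincomb:
  assumes "v \<in> tangent_space A p" "w \<in> tangent_space A p"
  shows "(\<lambda>f. a * v f + b * w f) \<in> tangent_space A p"
proof -
  obtain U \<phi> where U: "(U, \<phi>) \<in> A" "p \<in> U" by (rule chart_exists)
  obtain x y where "v = chart_vector A U \<phi> p x" "w = chart_vector A U \<phi> p y"
    using assms unfolding tangent_space_eq_range[OF U] by auto
  then have "(\<lambda>f. a * v f + b * w f) = chart_vector A U \<phi> p (a *\<^sub>R x + b *\<^sub>R y)"
    using chart_vector_linear[OF U] by (auto simp: linear_iff)
  then show ?thesis by (simp add: tangent_space_eq_range[OF U])
qed

lemma tangent_space_zero: "(\<lambda>f. 0) \<in> tangent_space A p"
proof -
  obtain U \<phi> where U: "(U, \<phi>) \<in> A" "p \<in> U" by (rule chart_exists)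
  have "(\<lambda>f. 0) = chart_vector A U \<phi> p 0"
    using linear_0[OF chart_vector_linear[OF U]] by auto
  then show ?thesis by (simp add: tangent_space_eq_range[OF U])
qed

lemma tangent_space_sum:
  assumes "\<And>i. i \<in> I \<Longrightarrow> e i \<in> tangent_space A p"
  shows "(\<lambda>f. \<Sum>i\<in>I. c i * e i f) \<in> tangent_space A p"
  using assms
proof (induction I rule: infinite_finite_induct)
  case (insert i I)
  then show ?case
    using tangent_space_lincomb[of "e i" p "\<lambda>f. \<Sum>i\<in>I. c i * e i f" "c i" 1] by simp
qed (auto simp: tangent_space_zero)

text \<open>Removes the derivatives of metric coefficients in Koszul's formula and of constant
  coefficients in the Leibniz rule.\<close>

lemma tangent_vector_const:
  assumes "v \<in> tangent_space A p"
  shows "v (\<lambda>q. c) = 0"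
proof -
  obtain U \<phi> where U: "(U, \<phi>) \<in> A" "p \<in> U" by (rule chart_exists)
  obtain w where "v = chart_vector A U \<phi> p w"
    using assms unfolding tangent_space_eq_range[OF U] by auto
  then show ?thesis by (simp add: chart_vector_def o_def)
qed

section \<open>Vector fields as a module over the smooth functions\<close>

lemma vector_field_tangent: "vector_field A X \<Longrightarrow> X p \<in> tangent_space A p"
  unfolding vector_field_def by (elim conjE) (rule spec)

lemma vector_field_smooth: "vector_field A X \<Longrightarrow> smooth_fun A f \<Longrightarrow> smooth_fun A (\<lambda>p. X p f)"
  unfolding vector_field_def by (elim conjE) (rule spec[where x = f, THEN mp])

lemma vector_field_lincomb:
  assumes "smooth_fun A s" "smooth_fun A t" "vector_field A X" "vector_field A Y"
  shows "vector_field A (\<lambda>p f. s p * X p f + t p * Y p f)"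
  unfolding vector_field_def
proof (intro conjI allI impI)
  show "(\<lambda>f. s p * X p f + t p * Y p f) \<in> tangent_space A p" for p
    by (intro tangent_space_lincomb vector_field_tangent assms)
  show "smooth_fun A (\<lambda>p. s p * X p f + t p * Y p f)" if "smooth_fun A f" for f
    by (intro smooth_fun_add smooth_fun_mult assms vector_field_smooth[OF _ that])
qed

lemma vector_field_zero: "vector_field A (\<lambda>p f. 0)"
  unfolding vector_field_def by (intro conjI allI impI tangent_space_zero smooth_fun_const)

lemma vector_field_add:
  "vector_field A X \<Longrightarrow> vector_field A Y \<Longrightarrow> vector_field A (\<lambda>p f. X p f + Y p f)"
  using vector_field_lincomb[of "\<lambda>p. 1" "\<lambda>p. 1" X Y] by (simp add: smooth_fun_const)

lemma vector_field_diff: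
  "vector_field A X \<Longrightarrow> vector_field A Y \<Longrightarrow> vector_field A (\<lambda>p f. X p f - Y p f)"
  using vector_field_lincomb[of "\<lambda>p. 1" "\<lambda>p. -1" X Y] by (simp add: smooth_fun_const)

lemma vector_field_scale:
  "smooth_fun A s \<Longrightarrow> vector_field A X \<Longrightarrow> vector_field A (\<lambda>p f. s p * X p f)"
  using vector_field_lincomb[of s "\<lambda>p. 0" X X] by (simp add: smooth_fun_const)

lemma vector_field_sum:
  assumes "\<And>i. i \<in> I \<Longrightarrow> smooth_fun A (c i)" "\<And>i. i \<in> I \<Longrightarrow> vector_field A (X i)"
  shows "vector_field A (\<lambda>p f. \<Sum>i\<in>I. c i p * X i p f)"
  using assms
proof (induction I rule: infinite_finite_induct)
  case (insert i I)
  then show ?case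
    using vector_field_lincomb[of "c i" "\<lambda>p. 1" "X i" "\<lambda>p f. \<Sum>i\<in>I. c i p * X i p f"]
    by (simp add: smooth_fun_const)
qed (auto simp: vector_field_zero)

end

section \<open>Global frames with constant metric coefficients\<close>

text \<open>Dimension count: the tangent space is a linear image of \<open>real^'n\<close>, and
  independence makes the coefficient map \<open>F\<close> into \<open>real^'n\<close> injective,
  hence onto.\<close>

lemma tangent_basis_if_independent:
  fixes A :: "('a::{t2_space, second_countable_topology}, real^'n::finite) chart set"
    and e :: "'n \<Rightarrow> 'a tvec"
  assumes "smooth_manifold A"
    and e: "\<And>i. e i \<in> tangent_space A p"
    and indep: "\<And>c :: real^'n. (\<lambda>f. \<Sum>i\<in>UNIV. c $ i * e i f) = (\<lambda>f. 0) \<Longrightarrow> c = 0"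
  shows "tangent_basis A p e"
proof -
  interpret smooth_mfd A by unfold_locales fact
  obtain U \<phi> where U: "(U, \<phi>) \<in> A" "p \<in> U" by (rule chart_exists)
  have "\<forall>i. \<exists>w. e i = chart_vector A U \<phi> p w"
    using e unfolding tangent_space_eq_range[OF U] by auto
  then obtain w where w: "\<And>i. e i = chart_vector A U \<phi> p (w i)" by metis
  define F where "F c = (\<Sum>i\<in>UNIV. c $ i *\<^sub>R w i)" for c :: "real^'n"
  have lin: "linear F"
    unfolding F_def
    by (intro linearI) (simp_all add: sum.distrib scaleR_add_left scaleR_sum_right)
  have F: "chart_vector A U \<phi> p (F c) = (\<lambda>f. \<Sum>i\<in>UNIV. c $ i * e i f)" for c
  proof
    fix f
    show "chart_vector A U \<phi> p (F c) f = (\<Sum>i\<in>UNIV. c $ i * e i f)"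
      unfolding F_def w linear_sum[OF chart_vector_linear[OF U]]
      by (simp add: linear_scale[OF chart_vector_linear[OF U]])
  qed
  have "inj F"
    unfolding linear_injective_0[OF lin]
  proof (intro allI impI)
    fix c assume "F c = 0"
    then have "(\<lambda>f. \<Sum>i\<in>UNIV. c $ i * e i f) = chart_vector A U \<phi> p 0" using F[of c] by simp
    also have "\<dots> = (\<lambda>f. 0)" using linear_0[OF chart_vector_linear[OF U]] by auto
    finally show "c = 0" by (rule indep)
  qed
  then have surj: "surj F" using lin by (simp add: linear_injective_imp_surjective)
  have "\<exists>!c. v = (\<lambda>f. \<Sum>i\<in>UNIV. c $ i * e i f)" if v: "v \<in> tangent_space A p" for v
  proof (rule ex_ex1I)
    obtain x where "v = chart_vector A U \<phi> p x"
      using v unfolding tangent_space_eq_range[OF U] by auto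
    moreover obtain c where "x = F c" using surjD[OF surj] by blast
    ultimately show "\<exists>c. v = (\<lambda>f. \<Sum>i\<in>UNIV. c $ i * e i f)" using F by auto
    fix c d :: "real^'n"
    assume "v = (\<lambda>f. \<Sum>i\<in>UNIV. c $ i * e i f)" "v = (\<lambda>f. \<Sum>i\<in>UNIV. d $ i * e i f)"
    then have "(\<lambda>f. \<Sum>i\<in>UNIV. (c - d) $ i * e i f) = (\<lambda>f. 0)"
      by (auto simp: fun_eq_iff left_diff_distrib sum_subtractf)
    then show "c = d" using indep[of "c - d"] by simp
  qed
  then show ?thesis using e unfolding tangent_basis_def by blast
qed

text \<open>Kept general because the final proof uses it for two metrics: for \<open>g\<close>, to
  establish the Norden property, and for \<open>gt\<close>, to compute curvature.\<close>

locale metric_frame = smooth_mfd A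
  for A :: "('a::{t2_space, second_countable_topology}, real^'n::finite) chart set" +
  fixes X :: "'n \<Rightarrow> 'a vfield" and h :: "'a form_field" and H Hi :: "real^'n^'n"
  assumes frame_vector_field: "vector_field A (X i)"
    and metric: "pseudo_riemannian A h"
    and metric_frame: "h p (X i p) (X j p) = H $ i $ j"
    and metric_inverse: "H ** Hi = mat 1"
begin

lemma frame_tangent: "X i p \<in> tangent_space A p"
  using frame_vector_field by (rule vector_field_tangent)

lemma metric_sym: "u \<in> tangent_space A p \<Longrightarrow> v \<in> tangent_space A p \<Longrightarrow> h p u v = h p v u"
  using metric unfolding pseudo_riemannian_def by blast

lemma metric_lincomb:
  "u \<in> tangent_space A p \<Longrightarrow> v \<in> tangent_space A p \<Longrightarrow> w \<in> tangent_space A p \<Longrightarrow>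
    h p (\<lambda>f. a * v f + b * w f) u = a * h p v u + b * h p w u"
  using metric unfolding pseudo_riemannian_def by blast

lemma metric_add_left:
  "u \<in> tangent_space A p \<Longrightarrow> v \<in> tangent_space A p \<Longrightarrow> w \<in> tangent_space A p \<Longrightarrow>
    h p (\<lambda>f. v f + w f) u = h p v u + h p w u"
  using metric_lincomb[of u p v w 1 1] by simp

lemma metric_scale_left:
  "u \<in> tangent_space A p \<Longrightarrow> v \<in> tangent_space A p \<Longrightarrow> h p (\<lambda>f. r * v f) u = r * h p v u"
  using metric_lincomb[of u p v v r 0] by simp

lemma metric_smooth:
  "vector_field A Y \<Longrightarrow> vector_field A Z \<Longrightarrow> smooth_fun A (\<lambda>p. h p (Y p) (Z p))"
  using metric unfolding pseudo_riemannian_def by blast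

lemma metric_sum:
  assumes "u \<in> tangent_space A p" "\<And>i. i \<in> I \<Longrightarrow> e i \<in> tangent_space A p"
  shows "h p (\<lambda>f. \<Sum>i\<in>I. c i * e i f) u = (\<Sum>i\<in>I. c i * h p (e i) u)"
proof -
  have zero: "h p (\<lambda>f. 0) u = 0"
    using metric_lincomb[OF assms(1) assms(1) assms(1), of 0 0] by simp
  show ?thesis using assms(2)
  proof (induction I rule: infinite_finite_induct)
    case (insert i I)
    then show ?case
      using metric_lincomb[OF assms(1), of "e i" "\<lambda>f. \<Sum>i\<in>I. c i * e i f" "c i" 1]
        tangent_space_sum[of I e p c] by simp
  qed (simp_all add: zero)
qed

text \<open>Coordinates are read off by pairing with the frame and raising the index. In this form
  their smooth dependence on the point is inherited from the smoothness of the metric.\<close>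

definition coord :: "'a \<Rightarrow> 'a tvec \<Rightarrow> 'n \<Rightarrow> real" where
  "coord p v k = (\<Sum>j\<in>UNIV. h p v (X j p) * Hi $ j $ k)"

lemma metric_inverse_sum: "(\<Sum>j\<in>UNIV. H $ i $ j * Hi $ j $ k) = (if i = k then 1 else 0)"
proof -
  have "(\<Sum>j\<in>UNIV. H $ i $ j * Hi $ j $ k) = (H ** Hi) $ i $ k" by (simp add: matrix_matrix_mult_def)
  also have "\<dots> = (if i = k then 1 else 0)" by (simp add: metric_inverse mat_def)
  finally show ?thesis .
qed

lemma coord_sum: "coord p (\<lambda>f. \<Sum>i\<in>UNIV. c i * X i p f) k = c k"
proof -
  have "coord p (\<lambda>f. \<Sum>i\<in>UNIV. c i * X i p f) k
      = (\<Sum>j\<in>UNIV. \<Sum>i\<in>UNIV. c i * (H $ i $ j * Hi $ j $ k))"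
    by (simp add: coord_def metric_sum[OF frame_tangent frame_tangent] metric_frame
        sum_distrib_right mult.assoc)
  also have "\<dots> = (\<Sum>i\<in>UNIV. c i * (\<Sum>j\<in>UNIV. H $ i $ j * Hi $ j $ k))"
    by (subst sum.swap) (simp add: sum_distrib_left)
  also have "\<dots> = c k" by (simp add: metric_inverse_sum if_distrib[of "times _"] cong: if_cong)
  finally show ?thesis .
qed

lemma tangent_basis_frame: "tangent_basis A p (\<lambda>i. X i p)"
proof (rule tangent_basis_if_independent[OF smooth_manifold frame_tangent])
  fix c :: "real^'n"
  assume 0: "(\<lambda>f. \<Sum>i\<in>UNIV. c $ i * X i p f) = (\<lambda>f. 0)"
  have "c $ k = 0" for k
    using coord_sum[of p "\<lambda>i. c $ i" k] coord_sum[of p "\<lambda>i. 0" k] unfolding 0 by simp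
  then show "c = 0" by (simp add: vec_eq_iff)
qed

lemma coord_expand:
  assumes "v \<in> tangent_space A p"
  shows "v = (\<lambda>f. \<Sum>i\<in>UNIV. coord p v i * X i p f)"
proof -
  obtain c :: "real^'n" where "v = (\<lambda>f. \<Sum>i\<in>UNIV. c $ i * X i p f)"
    using tangent_basis_frame assms unfolding tangent_basis_def by blast
  then show ?thesis using coord_sum[of p "\<lambda>i. c $ i"] by simp
qed

lemma coord_frame: "coord p (X i p) k = (if i = k then 1 else 0)"
  by (simp add: coord_def metric_frame metric_inverse_sum)

lemma coord_smooth: "vector_field A Y \<Longrightarrow> smooth_fun A (\<lambda>p. coord p (Y p) k)"
  unfolding coord_def
  by (intro smooth_fun_sum smooth_fun_mult metric_smooth frame_vector_field smooth_fun_const)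

text \<open>\<open>extend\<close> is a choice, so an extension has to exist: the combination of the
  global frame with the coordinates of \<open>v\<close> frozen as constants is one.\<close>

lemma extend:
  assumes "v \<in> tangent_space A p"
  shows "vector_field A (extend A p v)" "extend A p v p = v"
proof -
  have "vector_field A (\<lambda>q f. \<Sum>i\<in>UNIV. coord p v i * X i q f)"
    by (intro vector_field_sum smooth_fun_const frame_vector_field)
  then have "\<exists>Y. vector_field A Y \<and> Y p = v"
    using coord_expand[OF assms] by (intro exI[of _ "\<lambda>q f. \<Sum>i\<in>UNIV. coord p v i * X i q f"]) simp
  then have "vector_field A (extend A p v) \<and> extend A p v p = v"
    unfolding extend_def by (rule someI_ex)
  then show "vector_field A (extend A p v)" "extend A p v p = v" by auto
qed

text \<open>Linearity in the form in which it is consumed, as expansion along the frame. It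
  constrains \<open>T\<close> on tangent vectors only, since tensor fields are arbitrary
  elsewhere.\<close>

definition linear_at :: "'a \<Rightarrow> ('a tvec \<Rightarrow> real) \<Rightarrow> bool" where
  "linear_at p T \<longleftrightarrow> (\<forall>v\<in>tangent_space A p. T v = (\<Sum>i\<in>UNIV. coord p v i * T (X i p)))"

lemma linear_at_cong:
  "(\<And>v. v \<in> tangent_space A p \<Longrightarrow> S v = T v) \<Longrightarrow> linear_at p S \<longleftrightarrow> linear_at p T"
  unfolding linear_at_def using frame_tangent by simp

lemma linear_at_mult_left: "linear_at p T \<Longrightarrow> linear_at p (\<lambda>v. c * T v)"
  unfolding linear_at_def by (simp add: sum_distrib_left mult.left_commute)

lemma linear_at_mult_right: "linear_at p T \<Longrightarrow> linear_at p (\<lambda>v. T v * c)"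
  unfolding linear_at_def by (simp add: sum_distrib_right mult.assoc)

lemma linear_at_add: "linear_at p S \<Longrightarrow> linear_at p T \<Longrightarrow> linear_at p (\<lambda>v. S v + T v)"
  unfolding linear_at_def by (simp add: distrib_left sum.distrib)

lemma linear_at_diff: "linear_at p S \<Longrightarrow> linear_at p T \<Longrightarrow> linear_at p (\<lambda>v. S v - T v)"
  unfolding linear_at_def by (simp add: right_diff_distrib sum_subtractf)

lemma linear_at_sum: "(\<And>i. i \<in> I \<Longrightarrow> linear_at p (T i)) \<Longrightarrow> linear_at p (\<lambda>v. \<Sum>i\<in>I. T i v)"
proof (induction I rule: infinite_finite_induct)
  case (insert i I)
  then show ?case using linear_at_add[of p "T i" "\<lambda>v. \<Sum>i\<in>I. T i v"] by simp
qed (simp_all add: linear_at_def)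

lemma linear_at_metric:
  assumes "w \<in> tangent_space A p"
  shows "linear_at p (\<lambda>v. h p v w)" "linear_at p (h p w)"
proof -
  show *: "linear_at p (\<lambda>v. h p v w)"
    unfolding linear_at_def
  proof
    fix v assume "v \<in> tangent_space A p"
    then have "h p v w = h p (\<lambda>f. \<Sum>i\<in>UNIV. coord p v i * X i p f) w"
      using coord_expand by simp
    then show "h p v w = (\<Sum>i\<in>UNIV. coord p v i * h p (X i p) w)"
      by (simp add: metric_sum[OF assms frame_tangent])
  qed
  show "linear_at p (h p w)"
    using * metric_sym[OF assms] linear_at_cong[of p "h p w" "\<lambda>v. h p v w"] by simp
qed

lemma linear_at_eq_0:
  "linear_at p T \<Longrightarrow> (\<And>i. T (X i p) = 0) \<Longrightarrow> v \<in> tangent_space A p \<Longrightarrow> T v = 0"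
  unfolding linear_at_def by simp

text \<open>\<open>contract\<close> uses an unspecified basis, so this is the basis independence of
  the metric trace. Under the change of basis \<open>P\<close> with inverse \<open>Q\<close>, Gram
  matrix and form become \<open>P ** H ** transpose P\<close> and
  \<open>P ** ?b ** transpose P\<close>, the inverse Gram matrix becomes
  \<open>transpose Q ** Hi ** Q\<close>, and cyclicity of the trace cancels \<open>P\<close> against
  \<open>Q\<close>.\<close>

lemma contract_frame:
  assumes B1: "\<And>w. w \<in> tangent_space A p \<Longrightarrow> linear_at p (\<lambda>v. B v w)"
    and B2: "\<And>v. v \<in> tangent_space A p \<Longrightarrow> linear_at p (B v)"
  shows "contract A h p B = (\<Sum>i\<in>UNIV. \<Sum>j\<in>UNIV. Hi $ i $ j * B (X i p) (X j p))"
proof -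
  define e where "e = (SOME e :: 'n \<Rightarrow> 'a tvec. tangent_basis A p e)"
  have e: "tangent_basis A p e"
    unfolding e_def by (rule someI[of "tangent_basis A p"], rule tangent_basis_frame)
  then have eT: "e i \<in> tangent_space A p" for i by (simp add: tangent_basis_def)
  define P :: "real^'n^'n" where "P = (\<chi> i k. coord p (e i) k)"
  \<comment> \<open>Stated for any bilinear form, because it is applied both to the metric itself
    and to the given \<open>B\<close>.\<close>
  have bil: "(\<chi> i j. B (e i) (e j)) = P ** (\<chi> i j. B (X i p) (X j p)) ** transpose P"
    if B1: "\<And>w. w \<in> tangent_space A p \<Longrightarrow> linear_at p (\<lambda>v. B v w)"
      and B2: "\<And>v. v \<in> tangent_space A p \<Longrightarrow> linear_at p (B v)" for B
  proof -
    have "B (e i) (e j) = (\<Sum>l\<in>UNIV. (\<Sum>k\<in>UNIV. P $ i $ k * B (X k p) (X l p)) * P $ j $ l)" for i j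
    proof -
      have "B (e i) (e j) = (\<Sum>l\<in>UNIV. P $ j $ l * B (e i) (X l p))"
        using B2[OF eT] eT unfolding linear_at_def P_def by simp
      also have "\<dots> = (\<Sum>l\<in>UNIV. P $ j $ l * (\<Sum>k\<in>UNIV. P $ i $ k * B (X k p) (X l p)))"
        using B1[OF frame_tangent] eT unfolding linear_at_def P_def by simp
      finally show ?thesis by (simp add: mult.commute)
    qed
    then show ?thesis
      by (simp add: vec_eq_iff matrix_matrix_mult_def transpose_def)
  qed
  have "\<forall>i. \<exists>c :: real^'n. X i p = (\<lambda>f. \<Sum>k\<in>UNIV. c $ k * e k f)"
    using e frame_tangent unfolding tangent_basis_def by blast
  then obtain c :: "'n \<Rightarrow> real^'n" where c: "\<And>i. X i p = (\<lambda>f. \<Sum>k\<in>UNIV. c i $ k * e k f)"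
    by metis
  define Q :: "real^'n^'n" where "Q = (\<chi> i k. c i $ k)"
  have "(Q ** P) $ i $ l = mat 1 $ i $ l" for i l
  proof -
    \<comment> \<open>Taking coordinates of the expansion of \<open>X i p\<close> in the basis
      \<open>e\<close> turns the relation between the two bases into the matrix identity
      \<open>Q ** P = mat 1\<close>.\<close>
    have "coord p (X i p) l = (\<Sum>k\<in>UNIV. c i $ k * coord p (e k) l)"
      unfolding c[of i] coord_def[of p "\<lambda>f. \<Sum>k\<in>UNIV. c i $ k * e k f"]
        metric_sum[OF frame_tangent eT]
      by (simp add: coord_def sum_distrib_left sum_distrib_right mult.assoc) (rule sum.swap)
    then show ?thesis
      by (simp add: coord_frame matrix_matrix_mult_def Q_def P_def mat_def)
  qed
  then have QP: "Q ** P = mat 1" by (simp add: vec_eq_iff)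
  then have PQ: "P ** Q = mat 1" by (simp add: matrix_left_right_inverse)
  have HiH: "Hi ** H = mat 1" using metric_inverse by (simp add: matrix_left_right_inverse)
  have tPQ: "transpose P ** transpose Q = mat 1" "transpose Q ** transpose P = mat 1"
    using QP PQ by (simp_all add: matrix_transpose_mul[symmetric])
  let ?M = "\<chi> i j. h p (e i) (e j)"
  have "?M = P ** (\<chi> i j. h p (X i p) (X j p)) ** transpose P"
    using bil[of "h p"] linear_at_metric by blast
  also have "(\<chi> i j. h p (X i p) (X j p)) = H" by (simp add: vec_eq_iff metric_frame)
  finally have M: "?M = P ** H ** transpose P" .
  let ?N = "transpose Q ** Hi ** Q"
  have "?M ** ?N = P ** H ** (transpose P ** transpose Q) ** Hi ** Q"
    unfolding M by (simp add: matrix_mul_assoc)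
  also have "\<dots> = P ** (H ** Hi) ** Q" unfolding tPQ by (simp add: matrix_mul_assoc)
  also have "\<dots> = mat 1" by (simp add: metric_inverse PQ)
  finally have MN: "?M ** ?N = mat 1" .
  then have NM: "?N ** ?M = mat 1" by (simp add: matrix_left_right_inverse)
  \<comment> \<open>\<open>matrix_inv\<close> is a choice as well; two-sided inverses are unique, so
    the explicit one is the chosen one.\<close>
  have inv: "matrix_inv ?M = ?N"
  proof -
    have "?M ** matrix_inv ?M = mat 1 \<and> matrix_inv ?M ** ?M = mat 1"
      unfolding matrix_inv_def by (rule someI[of _ ?N]) (use MN NM in blast)
    then have "?N ** ?M ** matrix_inv ?M = ?N ** mat 1"
      by (simp add: matrix_mul_assoc[symmetric])
    then show ?thesis unfolding NM by simp
  qed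
  \<comment> \<open>The full contraction of two matrices is a trace once the first is transposed;
    this makes cyclicity available.\<close>
  have tr: "(\<Sum>i\<in>UNIV. \<Sum>j\<in>UNIV. (S::real^'n^'n) $ i $ j * T $ i $ j) = trace (transpose S ** T)" for S T
    unfolding trace_def by (subst sum.swap) (simp add: matrix_matrix_mult_def transpose_def)
  let ?b = "\<chi> i j. B (X i p) (X j p)"
  have b: "(\<chi> i j. B (e i) (e j)) = P ** ?b ** transpose P"
    by (rule bil) (use B1 B2 in auto)
  have "contract A h p B = (\<Sum>i\<in>UNIV. \<Sum>j\<in>UNIV. ?N $ i $ j * (\<chi> i j. B (e i) (e j)) $ i $ j)"
    unfolding contract_def Let_def e_def[symmetric] inv by simp
  also have "\<dots> = trace (transpose ?N ** (P ** ?b ** transpose P))"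
    unfolding tr b ..
  also have "transpose ?N ** (P ** ?b ** transpose P)
      = transpose Q ** (transpose Hi ** (Q ** P) ** ?b ** transpose P)"
    by (simp add: matrix_transpose_mul matrix_mul_assoc)
  also have "trace \<dots> = trace ((transpose Hi ** (Q ** P) ** ?b ** transpose P) ** transpose Q)"
    by (rule trace_mul_sym)
  also have "(transpose Hi ** (Q ** P) ** ?b ** transpose P) ** transpose Q
      = transpose Hi ** (Q ** P) ** ?b ** (transpose P ** transpose Q)"
    by (simp add: matrix_mul_assoc)
  also have "\<dots> = transpose Hi ** ?b" by (simp add: QP tPQ)
  also have "trace \<dots> = (\<Sum>i\<in>UNIV. \<Sum>j\<in>UNIV. Hi $ i $ j * B (X i p) (X j p))"
    unfolding tr[symmetric] by simp
  finally show ?thesis .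
qed

section \<open>Tensoriality and evaluation at a point\<close>

definition tensorial_at :: "'a \<Rightarrow> ('a vfield \<Rightarrow> real) \<Rightarrow> bool" where
  "tensorial_at p T \<longleftrightarrow>
     (\<forall>Y Z. vector_field A Y \<longrightarrow> vector_field A Z \<longrightarrow> T (\<lambda>q f. Y q f + Z q f) = T Y + T Z) \<and>
     (\<forall>s Y. smooth_fun A s \<longrightarrow> vector_field A Y \<longrightarrow> T (\<lambda>q f. s q * Y q f) = s p * T Y)"

text \<open>The value on each summand is left abstract, so that the lemma covers tensors with smooth
  coefficients as well as the second argument of a connection, where only constant coefficients come
  out.\<close>

lemma additive_sum:
  assumes add: "\<And>Y Z. vector_field A Y \<Longrightarrow> vector_field A Z \<Longrightarrow> T (\<lambda>q f. Y q f + Z q f) = T Y + T Z"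
    and scale: "\<And>i. i \<in> I \<Longrightarrow> T (\<lambda>q f. s i q * Y i q f) = (c i :: real)"
    and vf: "\<And>i. i \<in> I \<Longrightarrow> smooth_fun A (s i)" "\<And>i. i \<in> I \<Longrightarrow> vector_field A (Y i)"
  shows "T (\<lambda>q f. \<Sum>i\<in>I. s i q * Y i q f) = (\<Sum>i\<in>I. c i)"
proof -
  have zero: "T (\<lambda>q f. 0) = 0" using add[OF vector_field_zero vector_field_zero] by simp
  show ?thesis using scale vf
  proof (induction I rule: infinite_finite_induct)
    case (insert i I)
    then show ?case
      using add[of "\<lambda>q f. s i q * Y i q f" "\<lambda>q f. \<Sum>i\<in>I. s i q * Y i q f"]
      by (simp add: vector_field_scale vector_field_sum)
  qed (simp_all add: zero)
qed

text \<open>The frame coefficients of \<open>Y\<close> are smooth on the whole manifold, so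
  homogeneity applies to each summand and leaves only their values at \<open>p\<close>. Hence
  \<open>T Y\<close> depends on \<open>Y p\<close> alone.\<close>

lemma tensorial_at_expand:
  assumes T: "tensorial_at p T" and Y: "vector_field A Y"
  shows "T Y = (\<Sum>i\<in>UNIV. coord p (Y p) i * T (X i))"
proof -
  have "Y = (\<lambda>q f. \<Sum>i\<in>UNIV. coord q (Y q) i * X i q f)"
    using coord_expand[OF vector_field_tangent[OF Y]] by blast
  then have "T Y = T (\<lambda>q f. \<Sum>i\<in>UNIV. coord q (Y q) i * X i q f)" by simp
  also have "\<dots> = (\<Sum>i\<in>UNIV. coord p (Y p) i * T (X i))"
    using T coord_smooth[OF Y] frame_vector_field unfolding tensorial_at_def
    by (intro additive_sum) blast+
  finally show ?thesis .
qed

lemma tensorial_at_extend: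
  assumes T: "tensorial_at p T"
  shows "T (extend A p (X i p)) = T (X i)" "linear_at p (\<lambda>v. T (extend A p v))"
proof -
  show *: "T (extend A p (X i p)) = T (X i)" for i
    using tensorial_at_expand[OF T extend(1)[OF frame_tangent]] extend(2)[OF frame_tangent]
    by (simp add: coord_frame if_distrib[of "\<lambda>x. x * _"] cong: if_cong)
  show "linear_at p (\<lambda>v. T (extend A p v))"
    unfolding linear_at_def * using tensorial_at_expand[OF T extend(1)] extend(2) by simp
qed

end

section \<open>Curvature and covariant derivatives in a frame with constant structure coefficients\<close>

locale constant_frame = metric_frame A X h H Hi
  for A :: "('a::{t2_space, second_countable_topology}, real^'n::finite) chart set"
    and X :: "'n \<Rightarrow> 'a vfield" and h :: "'a form_field" and H Hi :: "real^'n^'n" +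
  fixes nabla :: "'a connection" and c :: "'n \<Rightarrow> 'n \<Rightarrow> 'n \<Rightarrow> real"
  assumes levi_civita: "levi_civita A h nabla"
    and frame_bracket: "bracket (X i) (X j) = (\<lambda>p f. \<Sum>k\<in>UNIV. c i j k * X k p f)"
begin

lemma nabla:
  assumes "vector_field A Y" "vector_field A Z"
  shows nabla_vector_field: "vector_field A (nabla Y Z)"
    and nabla_torsion: "bracket Y Z = (\<lambda>p f. nabla Y Z p f - nabla Z Y p f)"
    and nabla_scale_left: "smooth_fun A s \<Longrightarrow>
      nabla (\<lambda>p f. s p * Y p f) Z = (\<lambda>p f. s p * nabla Y Z p f)"
    and nabla_scale_right: "smooth_fun A s \<Longrightarrow>
      nabla Y (\<lambda>p f. s p * Z p f) = (\<lambda>p f. Y p s * Z p f + s p * nabla Y Z p f)"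
  using levi_civita assms unfolding levi_civita_def affine_connection_def by fastforce+

lemma nabla_add:
  assumes "vector_field A Y" "vector_field A Z" "vector_field A W"
  shows nabla_add_left: "nabla (\<lambda>p f. Y p f + Z p f) W = (\<lambda>p f. nabla Y W p f + nabla Z W p f)"
    and nabla_add_right: "nabla W (\<lambda>p f. Y p f + Z p f) = (\<lambda>p f. nabla W Y p f + nabla W Z p f)"
    and nabla_metric: "W p (\<lambda>q. h q (Y q) (Z q)) = h p (nabla W Y p) (Z p) + h p (Y p) (nabla W Z p)"
  using levi_civita assms unfolding levi_civita_def affine_connection_def by blast+

text \<open>Vanishing torsion writes the commutator as a difference of covariant derivatives, which
  are vector fields by the connection axioms. This takes the place of a calculation with mixed
  second derivatives.\<close>

lemma bracket_vector_field:
  assumes "vector_field A Y" "vector_field A Z"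
  shows "vector_field A (bracket Y Z)"
  unfolding nabla_torsion[OF assms]
  by (intro vector_field_diff nabla_vector_field assms)

text \<open>The components \<open>h([X i, X j], X k)\<close> of the bracket with its index
  lowered.\<close>

definition lower :: "'n \<Rightarrow> 'n \<Rightarrow> 'n \<Rightarrow> real" where
  "lower i j k = (\<Sum>m\<in>UNIV. c i j m * H $ m $ k)"

text \<open>Koszul's formula for a frame with constant metric coefficients, the last index raised by
  \<open>Hi\<close>.\<close>

definition christoffel :: "'n \<Rightarrow> 'n \<Rightarrow> 'n \<Rightarrow> real" where
  "christoffel i j k = (\<Sum>m\<in>UNIV. (lower i j m - lower j m i + lower m i j) / 2 * Hi $ m $ k)"

lemma nabla_frame: "nabla (X i) (X j) p = (\<lambda>f. \<Sum>k\<in>UNIV. christoffel i j k * X k p f)"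
proof -
  have T: "nabla (X i) (X j) p \<in> tangent_space A p" for i j
    by (intro vector_field_tangent nabla_vector_field frame_vector_field)
  define K where "K i j k = h p (nabla (X i) (X j) p) (X k p)" for i j k
  have skew: "K i j k + K i k j = 0" for i j k
  proof -
    have "K i j k + h p (X j p) (nabla (X i) (X k) p) = X i p (\<lambda>q. h q (X j q) (X k q))"
      unfolding K_def by (rule nabla_metric[symmetric]) (rule frame_vector_field)+
    also have "\<dots> = 0"
      unfolding metric_frame by (rule tangent_vector_const[OF frame_tangent])
    finally show ?thesis using metric_sym[OF frame_tangent T] by (simp add: K_def)
  qed
  have torsion: "K i j k - K j i k = lower i j k" for i j k
  proof -
    have "K i j k - K j i k = h p (bracket (X i) (X j) p) (X k p)"
      using metric_lincomb[OF frame_tangent[of k p] T[of i j] T[of j i], of 1 "-1"]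
      unfolding K_def nabla_torsion[OF frame_vector_field frame_vector_field] by simp
    also have "\<dots> = lower i j k"
      unfolding frame_bracket metric_sum[OF frame_tangent frame_tangent] by (simp add: lower_def metric_frame)
    finally show ?thesis .
  qed
  \<comment> \<open>Three skew relations and three torsion relations form a linear system; the
    alternating sum of the latter reduces to \<open>2 * K i j m\<close>.\<close>
  have K: "K i j m = (lower i j m - lower j m i + lower m i j) / 2" for m
    using skew[of i j m] skew[of j i m] skew[of m i j]
      torsion[of i j m] torsion[of j m i] torsion[of m i j] by simp
  have "coord p (nabla (X i) (X j) p) k = christoffel i j k" for k
    unfolding coord_def christoffel_def K_def[symmetric] K ..
  then show ?thesis using coord_expand[OF T[of i j]] by simp
qed

lemma nabla_frame_field: "nabla (X i) (X j) = (\<lambda>p f. \<Sum>k\<in>UNIV. christoffel i j k * X k p f)"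
  using nabla_frame by blast

lemma nabla_sum_left:
  assumes "vector_field A Z"
  shows "nabla (\<lambda>p f. \<Sum>k\<in>UNIV. a k * X k p f) Z p f = (\<Sum>k\<in>UNIV. a k * nabla (X k) Z p f)"
  using assms
  by (intro additive_sum[where T = "\<lambda>Y. nabla Y Z p f"] smooth_fun_const frame_vector_field)
     (simp_all add: nabla_add_left nabla_scale_left frame_vector_field smooth_fun_const)

lemma nabla_sum_right:
  assumes "vector_field A Y"
  shows "nabla Y (\<lambda>p f. \<Sum>k\<in>UNIV. a k * X k p f) p f = (\<Sum>k\<in>UNIV. a k * nabla Y (X k) p f)"
proof (intro additive_sum[where T = "\<lambda>Z. nabla Y Z p f"] smooth_fun_const frame_vector_field)
  fix k
  show "nabla Y (\<lambda>p f. a k * X k p f) p f = a k * nabla Y (X k) p f"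
    using nabla_scale_right[OF assms frame_vector_field smooth_fun_const, of "a k" k]
      tangent_vector_const[OF vector_field_tangent[OF assms]] by simp
qed (use assms in \<open>simp_all add: nabla_add_right\<close>)

text \<open>Through vanishing torsion, the rules for the bracket come from those for
  \<open>nabla\<close>; the same holds for the Leibniz rule that follows.\<close>

lemma bracket_add_left:
  assumes "vector_field A Y" "vector_field A Y'" "vector_field A Z"
  shows "bracket (\<lambda>p f. Y p f + Y' p f) Z = (\<lambda>p f. bracket Y Z p f + bracket Y' Z p f)"
  using assms by (simp add: nabla_torsion vector_field_add nabla_add_left nabla_add_right algebra_simps)

lemma bracket_scale_left:
  assumes "vector_field A Y" "vector_field A Z" "smooth_fun A s"
  shows "bracket (\<lambda>p f. s p * Y p f) Z = (\<lambda>p f. s p * bracket Y Z p f + (- Z p s) * Y p f)"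
  using assms
  by (simp add: nabla_torsion vector_field_scale nabla_scale_left nabla_scale_right algebra_simps)

lemma curv_vector_field:
  assumes "vector_field A Y" "vector_field A Z" "vector_field A W"
  shows "vector_field A (curv nabla Y Z W)"
  unfolding curv_def
  by (intro vector_field_diff nabla_vector_field bracket_vector_field assms)

lemma curv_tangent:
  "vector_field A Y \<Longrightarrow> vector_field A Z \<Longrightarrow> vector_field A W \<Longrightarrow>
    curv nabla Y Z W p \<in> tangent_space A p"
  by (rule vector_field_tangent[OF curv_vector_field])

lemma curv_add_left:
  assumes "vector_field A Y" "vector_field A Y'" "vector_field A Z" "vector_field A W"
  shows "curv nabla (\<lambda>p f. Y p f + Y' p f) Z W
    = (\<lambda>p f. curv nabla Y Z W p f + curv nabla Y' Z W p f)"
  using assms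
  by (simp add: curv_def bracket_add_left nabla_add_left nabla_add_right nabla_vector_field
      bracket_vector_field algebra_simps)

text \<open>Differentiating \<open>s\<close> along \<open>Z\<close> gives a multiple of
  \<open>nabla Y W\<close> twice: from \<open>nabla Z (s * nabla Y W)\<close> and from the bracket
  of \<open>s * Y\<close> with \<open>Z\<close>. The two cancel.\<close>

lemma curv_scale_left:
  assumes "vector_field A Y" "vector_field A Z" "vector_field A W" "smooth_fun A s"
  shows "curv nabla (\<lambda>p f. s p * Y p f) Z W = (\<lambda>p f. s p * curv nabla Y Z W p f)"
proof -
  have "smooth_fun A (\<lambda>p. - Z p s)"
    using smooth_fun_mult[OF smooth_fun_const[of "-1"] vector_field_smooth[OF assms(2,4)]] by simp
  then have "nabla (bracket (\<lambda>p f. s p * Y p f) Z) W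
      = (\<lambda>p f. s p * nabla (bracket Y Z) W p f + (- Z p s) * nabla Y W p f)"
    unfolding bracket_scale_left[OF assms(1,2,4)]
    by (subst nabla_add_left)
       (simp_all only: assms vector_field_scale bracket_vector_field nabla_scale_left)
  then show ?thesis
    using assms
    by (simp add: curv_def nabla_scale_left nabla_scale_right nabla_vector_field algebra_simps)
qed

lemma curv_skew:
  assumes "vector_field A Y" "vector_field A Z" "vector_field A W"
  shows "curv nabla Y Z W = (\<lambda>p f. - 1 * curv nabla Z Y W p f)"
proof -
  have "bracket Y Z = (\<lambda>p f. - 1 * bracket Z Y p f)"
    using assms by (simp add: nabla_torsion)
  then have "nabla (bracket Y Z) W = (\<lambda>p f. - 1 * nabla (bracket Z Y) W p f)"
    using nabla_scale_left[OF bracket_vector_field[OF assms(2,1)] assms(3) smooth_fun_const, of "- 1"]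
    by simp
  then show ?thesis by (simp add: curv_def algebra_simps)
qed

lemma curv_add_right:
  assumes "vector_field A Y" "vector_field A Z" "vector_field A W" "vector_field A W'"
  shows "curv nabla Y Z (\<lambda>p f. W p f + W' p f)
    = (\<lambda>p f. curv nabla Y Z W p f + curv nabla Y Z W' p f)"
  using assms
  by (simp add: curv_def nabla_add_right nabla_vector_field bracket_vector_field algebra_simps)

text \<open>The mixed first-order terms are symmetric in \<open>Y\<close> and \<open>Z\<close> and
  drop out of the commutator; the second derivatives of \<open>s\<close> leave exactly the
  derivative along the bracket, which the third curvature term subtracts.\<close>

lemma curv_scale_right:
  assumes "vector_field A Y" "vector_field A Z" "vector_field A W" "smooth_fun A s"
  shows "curv nabla Y Z (\<lambda>p f. s p * W p f) = (\<lambda>p f. s p * curv nabla Y Z W p f)"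
proof -
  have *: "nabla U (nabla V (\<lambda>p f. s p * W p f))
      = (\<lambda>p f. U p (\<lambda>q. V q s) * W p f + V p s * nabla U W p f
          + (U p s * nabla V W p f + s p * nabla U (nabla V W) p f))"
    if "vector_field A U" "vector_field A V" for U V
    using that assms vector_field_smooth[OF that(2) assms(4)]
    by (simp add: nabla_scale_right nabla_add_right nabla_vector_field vector_field_scale)
  have br: "bracket Y Z p s = Y p (\<lambda>q. Z q s) - Z p (\<lambda>q. Y q s)" for p
    by (simp add: bracket_def)
  show ?thesis
    unfolding curv_def *[OF assms(1,2)] *[OF assms(2,1)]
      nabla_scale_right[OF bracket_vector_field[OF assms(1,2)] assms(3,4)] br
    by (simp add: algebra_simps)
qed

lemma tensorial_at_curv:
  assumes "vector_field A Y" "vector_field A Z" and u: "u \<in> tangent_space A p"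
  shows "tensorial_at p (\<lambda>W. h p (curv nabla W Y Z p) u)"
    and "tensorial_at p (\<lambda>W. h p (curv nabla Y W Z p) u)"
    and "tensorial_at p (\<lambda>W. h p (curv nabla Y Z W p) u)"
proof -
  note T = curv_tangent
  show left: "tensorial_at p (\<lambda>W. h p (curv nabla W Y Z p) u)"
    using assms by (simp add: tensorial_at_def curv_add_left curv_scale_left metric_add_left metric_scale_left T u)
  show "tensorial_at p (\<lambda>W. h p (curv nabla Y Z W p) u)"
    using assms by (simp add: tensorial_at_def curv_add_right curv_scale_right metric_add_left metric_scale_left T u)
  \<comment> \<open>The second argument is reduced to the first by skew symmetry.\<close>
  have "h p (curv nabla Y W Z p) u = - h p (curv nabla W Y Z p) u" if "vector_field A W" for W
    using curv_skew[OF assms(1) that assms(2)] metric_scale_left[OF u T[of W Y Z], of "-1"] that assms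
    by simp
  then show "tensorial_at p (\<lambda>W. h p (curv nabla Y W Z p) u)"
    using left by (simp add: tensorial_at_def vector_field_add vector_field_scale)
qed

section \<open>Curvature components in the frame\<close>

definition riemann :: "'n \<Rightarrow> 'n \<Rightarrow> 'n \<Rightarrow> 'n \<Rightarrow> real" where
  "riemann i j k l = (\<Sum>m\<in>UNIV. christoffel j k m * christoffel i m l
     - christoffel i k m * christoffel j m l - c i j m * christoffel m k l)"

lemma curv_frame:
  "curv nabla (X i) (X j) (X k) = (\<lambda>p f. \<Sum>l\<in>UNIV. riemann i j k l * X l p f)"
proof (intro ext)
  fix p f
  have sw: "(\<Sum>m\<in>UNIV. a m * (\<Sum>l\<in>UNIV. b m l * X l p f))
      = (\<Sum>l\<in>UNIV. (\<Sum>m\<in>UNIV. a m * b m l) * X l p f)" for a and b :: "'n \<Rightarrow> 'n \<Rightarrow> real"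
    unfolding sum_distrib_left sum_distrib_right by (subst sum.swap) (simp add: mult.assoc)
  have "nabla (X i) (nabla (X j) (X k)) p f
      = (\<Sum>l\<in>UNIV. (\<Sum>m\<in>UNIV. christoffel j k m * christoffel i m l) * X l p f)" for i j
    unfolding nabla_frame_field[of j k] nabla_sum_right[OF frame_vector_field]
    unfolding nabla_frame by (rule sw)
  moreover have "nabla (bracket (X i) (X j)) (X k) p f
      = (\<Sum>l\<in>UNIV. (\<Sum>m\<in>UNIV. c i j m * christoffel m k l) * X l p f)"
    unfolding frame_bracket nabla_sum_left[OF frame_vector_field]
    unfolding nabla_frame by (rule sw)
  ultimately show "curv nabla (X i) (X j) (X k) p f = (\<Sum>l\<in>UNIV. riemann i j k l * X l p f)"
    by (simp add: curv_def riemann_def sum_subtractf left_diff_distrib)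
qed

definition riemann_lower :: "'n \<Rightarrow> 'n \<Rightarrow> 'n \<Rightarrow> 'n \<Rightarrow> real" where
  "riemann_lower i j k l = (\<Sum>m\<in>UNIV. riemann i j k m * H $ m $ l)"

lemma linear_at_curv_at:
  assumes "x \<in> tangent_space A p" "y \<in> tangent_space A p" "z \<in> tangent_space A p"
  shows "linear_at p (\<lambda>v. curv_at A nabla h p v x y z)"
    and "linear_at p (\<lambda>v. curv_at A nabla h p x v y z)"
    and "linear_at p (\<lambda>v. curv_at A nabla h p x y v z)"
    and "linear_at p (\<lambda>v. curv_at A nabla h p x y z v)"
  unfolding curv_at_def
  using assms extend
  by (auto intro!: tensorial_at_extend(2)[OF tensorial_at_curv(1)]
      tensorial_at_extend(2)[OF tensorial_at_curv(2)] tensorial_at_extend(2)[OF tensorial_at_curv(3)]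
      linear_at_metric curv_tangent)

lemma curv_at_frame: "curv_at A nabla h p (X i p) (X j p) (X k p) (X l p) = riemann_lower i j k l"
proof -
  note E = extend(1)[OF frame_tangent] and V = frame_vector_field and T = frame_tangent
  \<comment> \<open>The chosen extensions are exchanged for frame fields one argument at a time, the
    other arguments being genuine vector fields at each exchange.\<close>
  have "curv_at A nabla h p (X i p) (X j p) (X k p) (X l p)
      = h p (curv nabla (X i) (X j) (X k) p) (X l p)"
    unfolding curv_at_def
    tensorial_at_extend(1)[OF tensorial_at_curv(1)[OF E E T]]
    tensorial_at_extend(1)[OF tensorial_at_curv(2)[OF V E T]]
    tensorial_at_extend(1)[OF tensorial_at_curv(3)[OF V V T]] ..
  also have "\<dots> = riemann_lower i j k l"
    unfolding curv_frame metric_sum[OF T T] by (simp add: riemann_lower_def metric_frame)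
  finally show ?thesis .
qed

definition ricci_frame :: "'n \<Rightarrow> 'n \<Rightarrow> real" where
  "ricci_frame j k = (\<Sum>i\<in>UNIV. \<Sum>l\<in>UNIV. Hi $ i $ l * riemann_lower i j k l)"

lemma ricci_eq:
  assumes "y \<in> tangent_space A p" "z \<in> tangent_space A p"
  shows "ricci A nabla h p y z
    = (\<Sum>i\<in>UNIV. \<Sum>l\<in>UNIV. Hi $ i $ l * curv_at A nabla h p (X i p) y z (X l p))"
  unfolding ricci_def by (intro contract_frame linear_at_curv_at assms)

text \<open>The Ricci form is contracted again in the scalar curvature and enters the Weyl tensor,
  so it must itself be bilinear.\<close>

lemma linear_at_ricci:
  assumes "y \<in> tangent_space A p"
  shows "linear_at p (\<lambda>v. ricci A nabla h p v y)" "linear_at p (ricci A nabla h p y)"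
proof -
  have "linear_at p (\<lambda>v. \<Sum>i\<in>UNIV. \<Sum>l\<in>UNIV. Hi $ i $ l * curv_at A nabla h p (X i p) v y (X l p))"
    "linear_at p (\<lambda>v. \<Sum>i\<in>UNIV. \<Sum>l\<in>UNIV. Hi $ i $ l * curv_at A nabla h p (X i p) y v (X l p))"
    by (intro linear_at_sum linear_at_mult_left linear_at_curv_at frame_tangent assms)+
  then show "linear_at p (\<lambda>v. ricci A nabla h p v y)" "linear_at p (ricci A nabla h p y)"
    using ricci_eq assms linear_at_cong by (metis (mono_tags, lifting))+
qed

lemma ricci_frame: "ricci A nabla h p (X j p) (X k p) = ricci_frame j k"
  by (simp add: ricci_eq frame_tangent curv_at_frame ricci_frame_def)

lemma scalar_curvature_frame:
  "scalar_curvature A nabla h p = (\<Sum>j\<in>UNIV. \<Sum>k\<in>UNIV. Hi $ j $ k * ricci_frame j k)"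
proof -
  have "contract A h p (ricci A nabla h p)
      = (\<Sum>j\<in>UNIV. \<Sum>k\<in>UNIV. Hi $ j $ k * ricci A nabla h p (X j p) (X k p))"
    by (intro contract_frame linear_at_ricci)
  then show ?thesis by (simp add: scalar_curvature_def ricci_frame)
qed

end

locale almost_complex_mfd = smooth_mfd A
  for A :: "('a::{t2_space, second_countable_topology}, 'e::euclidean_space) chart set" +
  fixes J :: "'a endo_field"
  assumes J: "almost_complex A J"
begin

lemma J_tangent: "v \<in> tangent_space A p \<Longrightarrow> J p v \<in> tangent_space A p"
  using J unfolding almost_complex_def by blast

lemma J_lincomb: "v \<in> tangent_space A p \<Longrightarrow> w \<in> tangent_space A p \<Longrightarrow>
    J p (\<lambda>f. r * v f + s * w f) = (\<lambda>f. r * J p v f + s * J p w f)"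
  using J unfolding almost_complex_def by blast

lemma J_add: "v \<in> tangent_space A p \<Longrightarrow> w \<in> tangent_space A p \<Longrightarrow>
    J p (\<lambda>f. v f + w f) = (\<lambda>f. J p v f + J p w f)"
  using J_lincomb[of v p w 1 1] by simp

lemma J_scale: "v \<in> tangent_space A p \<Longrightarrow> J p (\<lambda>f. r * v f) = (\<lambda>f. r * J p v f)"
  using J_lincomb[of v p v r 0] by simp

lemma J_vector_field: "vector_field A Y \<Longrightarrow> vector_field A (\<lambda>p. J p (Y p))"
  using J unfolding almost_complex_def by blast

lemma J_sum:
  assumes "\<And>i. i \<in> I \<Longrightarrow> e i \<in> tangent_space A p"
  shows "J p (\<lambda>f. \<Sum>i\<in>I. r i * e i f) = (\<lambda>f. \<Sum>i\<in>I. r i * J p (e i) f)"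
  using assms
proof (induction I rule: infinite_finite_induct)
  case (insert i I)
  then show ?case
    using J_lincomb[of "e i" p "\<lambda>f. \<Sum>i\<in>I. r i * e i f" "r i" 1]
      tangent_space_sum[of I e p r] by simp
\<comment> \<open>The empty sum needs \<open>J p\<close> to fix the zero functional, which is
  homogeneity with factor 0.\<close>
qed (use J_scale[OF tangent_space_zero, where r = 0] in simp_all)

lemma J_square: "v \<in> tangent_space A p \<Longrightarrow> J p (J p v) = (\<lambda>f. - v f)"
  using J unfolding almost_complex_def by blast

end

text \<open>\<open>J\<close> is self-adjoint for a Norden metric, which makes the associated form
  symmetric; nondegeneracy passes over because \<open>J\<close> is onto.\<close>

lemma norden_metric_associated:
  fixes A :: "('a::{t2_space, second_countable_topology}, 'e::euclidean_space) chart set"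
  assumes "smooth_manifold A" and g: "norden_metric A J g"
  shows "norden_metric A J (associated_metric J g)"
proof -
  interpret almost_complex_mfd A J
    using assms by unfold_locales (auto simp: norden_metric_def)
  have pr: "pseudo_riemannian A g"
    and anti: "\<And>p v w. v \<in> tangent_space A p \<Longrightarrow> w \<in> tangent_space A p \<Longrightarrow>
      g p (J p v) (J p w) = - g p v w"
    using g by (auto simp: norden_metric_def)
  have sym: "g p u v = g p v u" if "u \<in> tangent_space A p" "v \<in> tangent_space A p" for p u v
    using pr that unfolding pseudo_riemannian_def by blast
  have lin: "g p (\<lambda>f. a * v f + b * w f) u = a * g p v u + b * g p w u"
    if "u \<in> tangent_space A p" "v \<in> tangent_space A p" "w \<in> tangent_space A p" for p u v w a b
    using pr that unfolding pseudo_riemannian_def by blast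
  have neg: "g p v (\<lambda>f. - u f) = - g p v u" "(\<lambda>f. - u f) \<in> tangent_space A p"
    if "u \<in> tangent_space A p" "v \<in> tangent_space A p" for p u v
  proof -
    show *: "(\<lambda>f. - u f) \<in> tangent_space A p"
      using tangent_space_lincomb[OF that(1) that(1), of "-1" 0] by simp
    show "g p v (\<lambda>f. - u f) = - g p v u"
      using lin[OF that(2,1,1), of "-1" 0] sym[OF that(2) *] sym[OF that] by simp
  qed
  \<comment> \<open>Apply the Norden identity to \<open>u\<close> and \<open>J p v\<close>, and
    replace \<open>J p (J p v)\<close> by minus \<open>v\<close>.\<close>
  have self: "g p u (J p v) = g p v (J p u)"
    if "u \<in> tangent_space A p" "v \<in> tangent_space A p" for p u v
    using anti[OF that(1) J_tangent[OF that(2)]] neg(1)[OF that(2) J_tangent[OF that(1)]]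
      sym[OF that(2) J_tangent[OF that(1)]] J_square[OF that(2)] by simp
  have nondeg: "u = (\<lambda>f. 0)"
    if u: "u \<in> tangent_space A p" and 0: "\<And>v. v \<in> tangent_space A p \<Longrightarrow> g p u (J p v) = 0" for p u
  proof -
    have "g p u w = 0" if w: "w \<in> tangent_space A p" for w
      using 0[OF J_tangent[OF w]] neg(1)[OF w u] J_square[OF w] by simp
    then show ?thesis using pr u unfolding pseudo_riemannian_def by blast
  qed
  have "smooth_fun A (\<lambda>p. g p (Y p) (J p (Z p)))"
    if "vector_field A Y" "vector_field A Z" for Y Z
    using pr that(1) J_vector_field[OF that(2)] unfolding pseudo_riemannian_def by blast
  then have "pseudo_riemannian A (associated_metric J g)"
    unfolding pseudo_riemannian_def associated_metric_def
    by (intro conjI allI ballI impI) (simp_all add: self lin J_tangent nondeg)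
  moreover have "g p (J p v) (J p (J p w)) = - g p v (J p w)"
    if "v \<in> tangent_space A p" "w \<in> tangent_space A p" for p v w
    using anti that J_tangent by blast
  ultimately show ?thesis
    using J by (simp add: norden_metric_def associated_metric_def)
qed

section \<open>The covariant derivative of the almost complex structure\<close>

locale constant_frame_J = constant_frame A X h H Hi nabla c + almost_complex_mfd A J
  for A :: "('a::{t2_space, second_countable_topology}, real^'n::finite) chart set"
    and X h H Hi nabla c J +
  fixes a :: "'n \<Rightarrow> 'n \<Rightarrow> real"
  assumes J_frame: "J p (X i p) = (\<lambda>f. \<Sum>k\<in>UNIV. a i k * X k p f)"
begin

lemma nabla_J_vector_field:
  "vector_field A Y \<Longrightarrow> vector_field A Z \<Longrightarrow> vector_field A (nabla_J nabla J Y Z)"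
  unfolding nabla_J_def
  by (intro vector_field_diff nabla_vector_field J_vector_field)

lemma nabla_J_tangent:
  "vector_field A Y \<Longrightarrow> vector_field A Z \<Longrightarrow> nabla_J nabla J Y Z p \<in> tangent_space A p"
  by (rule vector_field_tangent[OF nabla_J_vector_field])

text \<open>In the second argument the Leibniz rule adds the derivative of \<open>s\<close> times
  \<open>J V\<close> to both terms of \<open>nabla_J\<close>, by linearity of \<open>J\<close>, and
  the difference is free of it.\<close>

lemma tensorial_at_nabla_J:
  assumes Y: "vector_field A Y" and u: "u \<in> tangent_space A p"
  shows "tensorial_at p (\<lambda>W. h p (nabla_J nabla J W Y p) u)"
    and "tensorial_at p (\<lambda>W. h p (nabla_J nabla J Y W p) u)"
proof -
  note T = nabla_J_tangent
  have "nabla_J nabla J (\<lambda>p f. V p f + W p f) Y = (\<lambda>p f. nabla_J nabla J V Y p f + nabla_J nabla J W Y p f)"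
    "nabla_J nabla J Y (\<lambda>p f. V p f + W p f) = (\<lambda>p f. nabla_J nabla J Y V p f + nabla_J nabla J Y W p f)"
    if "vector_field A V" "vector_field A W" for V W
    using that Y
    by (simp_all add: nabla_J_def nabla_add_left nabla_add_right J_vector_field J_add
        vector_field_tangent nabla_vector_field algebra_simps)
  moreover have "nabla_J nabla J (\<lambda>p f. s p * V p f) Y = (\<lambda>p f. s p * nabla_J nabla J V Y p f)"
    "nabla_J nabla J Y (\<lambda>p f. s p * V p f) = (\<lambda>p f. s p * nabla_J nabla J Y V p f)"
    if "vector_field A V" "smooth_fun A s" for s V
    using that Y
    by (simp_all add: nabla_J_def nabla_scale_left nabla_scale_right J_vector_field J_scale J_lincomb
        vector_field_tangent nabla_vector_field right_diff_distrib)
  ultimately show "tensorial_at p (\<lambda>W. h p (nabla_J nabla J W Y p) u)"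
     "tensorial_at p (\<lambda>W. h p (nabla_J nabla J Y W p) u)"
    using Y by (simp_all add: tensorial_at_def metric_add_left metric_scale_left T u)
qed

definition nabla_J_frame :: "'n \<Rightarrow> 'n \<Rightarrow> 'n \<Rightarrow> real" where
  "nabla_J_frame i j l = (\<Sum>m\<in>UNIV. a j m * christoffel i m l - christoffel i j m * a m l)"

lemma nabla_J_frame:
  "nabla_J nabla J (X i) (X j) p = (\<lambda>f. \<Sum>l\<in>UNIV. nabla_J_frame i j l * X l p f)"
proof
  fix f
  have sw: "(\<Sum>m\<in>UNIV. r m * (\<Sum>l\<in>UNIV. b m l * X l p f))
      = (\<Sum>l\<in>UNIV. (\<Sum>m\<in>UNIV. r m * b m l) * X l p f)" for r and b :: "'n \<Rightarrow> 'n \<Rightarrow> real"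
    unfolding sum_distrib_left sum_distrib_right by (subst sum.swap) (simp add: mult.assoc)
  have "nabla (X i) (\<lambda>q. J q (X j q)) p f = (\<Sum>l\<in>UNIV. (\<Sum>m\<in>UNIV. a j m * christoffel i m l) * X l p f)"
    unfolding J_frame nabla_sum_right[OF frame_vector_field] nabla_frame by (rule sw)
  moreover have "J p (nabla (X i) (X j) p) f = (\<Sum>l\<in>UNIV. (\<Sum>m\<in>UNIV. christoffel i j m * a m l) * X l p f)"
    unfolding nabla_frame J_sum[OF frame_tangent] J_frame by (rule sw)
  ultimately show "nabla_J nabla J (X i) (X j) p f = (\<Sum>l\<in>UNIV. nabla_J_frame i j l * X l p f)"
    by (simp add: nabla_J_def nabla_J_frame_def sum_subtractf left_diff_distrib)
qed

lemma nabla_J_at_tangent: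
  "x \<in> tangent_space A p \<Longrightarrow> y \<in> tangent_space A p \<Longrightarrow> nabla_J_at A nabla J p x y \<in> tangent_space A p"
  unfolding nabla_J_at_def by (intro nabla_J_tangent extend)

lemma linear_at_nabla_J_at:
  assumes "x \<in> tangent_space A p" "u \<in> tangent_space A p"
  shows "linear_at p (\<lambda>v. h p (nabla_J_at A nabla J p v x) u)"
    and "linear_at p (\<lambda>v. h p (nabla_J_at A nabla J p x v) u)"
    and "linear_at p (\<lambda>v. h p u (nabla_J_at A nabla J p v x))"
    and "linear_at p (\<lambda>v. h p u (nabla_J_at A nabla J p x v))"
proof -
  show *: "linear_at p (\<lambda>v. h p (nabla_J_at A nabla J p v x) u)"
    "linear_at p (\<lambda>v. h p (nabla_J_at A nabla J p x v) u)"
    unfolding nabla_J_at_def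
    using assms extend
    by (auto intro!: tensorial_at_extend(2)[OF tensorial_at_nabla_J(1)]
      tensorial_at_extend(2)[OF tensorial_at_nabla_J(2)])
  show "linear_at p (\<lambda>v. h p u (nabla_J_at A nabla J p v x))"
    using *(1) by (rule linear_at_cong[THEN iffD1, rotated])
      (intro metric_sym nabla_J_at_tangent assms)
  show "linear_at p (\<lambda>v. h p u (nabla_J_at A nabla J p x v))"
    using *(2) by (rule linear_at_cong[THEN iffD1, rotated])
      (intro metric_sym nabla_J_at_tangent assms)
qed

lemma nabla_J_at_frame:
  "h p (nabla_J_at A nabla J p (X i p) (X k p)) (nabla_J_at A nabla J p (X j p) (X l p))
    = (\<Sum>r\<in>UNIV. \<Sum>s\<in>UNIV. nabla_J_frame i k r * nabla_J_frame j l s * H $ r $ s)"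
proof -
  have eq: "nabla_J_at A nabla J p (X i p) (X k p) = (\<lambda>f. \<Sum>r\<in>UNIV. nabla_J_frame i k r * X r p f)"
    (is "?v = ?w") for i k
  proof -
    have w: "?w \<in> tangent_space A p" by (intro tangent_space_sum frame_tangent)
    have v: "?v \<in> tangent_space A p" by (intro nabla_J_at_tangent frame_tangent)
    \<comment> \<open>Tensoriality is available for real-valued expressions, so the vectors are
      compared through their pairings with the frame, which determine the coordinates.\<close>
    have "h p ?v (X m p) = h p (nabla_J nabla J (X i) (X k) p) (X m p)" for m
      unfolding nabla_J_at_def
        tensorial_at_extend(1)[OF tensorial_at_nabla_J(1)[OF extend(1)[OF frame_tangent] frame_tangent]]
        tensorial_at_extend(1)[OF tensorial_at_nabla_J(2)[OF frame_vector_field frame_tangent]] ..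
    then have "coord p ?v m = coord p ?w m" for m
      unfolding coord_def nabla_J_frame by simp
    then show ?thesis using coord_expand[OF v] coord_expand[OF w] by simp
  qed
  have "h p (\<lambda>f. \<Sum>r\<in>UNIV. b r * X r p f) (\<lambda>f. \<Sum>s\<in>UNIV. d s * X s p f)
      = (\<Sum>r\<in>UNIV. \<Sum>s\<in>UNIV. b r * d s * H $ r $ s)" for b d
  proof -
    have "h p (X r p) (\<lambda>f. \<Sum>s\<in>UNIV. d s * X s p f) = (\<Sum>s\<in>UNIV. d s * H $ r $ s)" for r
    proof -
      have "h p (X r p) (\<lambda>f. \<Sum>s\<in>UNIV. d s * X s p f) = h p (\<lambda>f. \<Sum>s\<in>UNIV. d s * X s p f) (X r p)"
        by (intro metric_sym tangent_space_sum frame_tangent)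
      also have "\<dots> = (\<Sum>s\<in>UNIV. d s * h p (X r p) (X s p))"
        by (simp add: metric_sum[OF frame_tangent frame_tangent] metric_sym[OF frame_tangent frame_tangent])
      finally show ?thesis by (simp add: metric_frame)
    qed
    then show ?thesis
      by (subst metric_sum) (auto intro!: tangent_space_sum frame_tangent
          simp: sum_distrib_left mult.assoc)
  qed
  then show ?thesis unfolding eq .
qed

lemma square_norm_nabla_J_frame:
  "square_norm_nabla_J A nabla J h p = (\<Sum>i\<in>UNIV. \<Sum>j\<in>UNIV. Hi $ i $ j *
     (\<Sum>k\<in>UNIV. \<Sum>l\<in>UNIV. Hi $ k $ l *
       (\<Sum>r\<in>UNIV. \<Sum>s\<in>UNIV. nabla_J_frame i k r * nabla_J_frame j l s * H $ r $ s)))"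
proof -
  let ?N = "nabla_J_at A nabla J p"
  let ?B = "\<lambda>x y. contract A h p (\<lambda>ek el. h p (?N x ek) (?N y el))"
  have inner: "?B x y = (\<Sum>k\<in>UNIV. \<Sum>l\<in>UNIV. Hi $ k $ l * h p (?N x (X k p)) (?N y (X l p)))"
    if "x \<in> tangent_space A p" "y \<in> tangent_space A p" for x y
    by (intro contract_frame linear_at_nabla_J_at nabla_J_at_tangent that)
  \<comment> \<open>The form contracted here is itself a contraction with an unspecified basis; its
    bilinearity becomes visible after \<open>inner\<close> rewrites it as a sum over the
    frame.\<close>
  have "contract A h p ?B = (\<Sum>i\<in>UNIV. \<Sum>j\<in>UNIV. Hi $ i $ j * ?B (X i p) (X j p))"
  proof (rule contract_frame)
    fix y assume y: "y \<in> tangent_space A p"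
    have "linear_at p (\<lambda>x. \<Sum>k\<in>UNIV. \<Sum>l\<in>UNIV. Hi $ k $ l * h p (?N x (X k p)) (?N y (X l p)))"
      by (intro linear_at_sum linear_at_mult_left linear_at_nabla_J_at nabla_J_at_tangent frame_tangent y)
    then show "linear_at p (\<lambda>x. ?B x y)"
      by (rule linear_at_cong[THEN iffD1, rotated]) (simp add: inner y)
    have "linear_at p (\<lambda>x. \<Sum>k\<in>UNIV. \<Sum>l\<in>UNIV. Hi $ k $ l * h p (?N y (X k p)) (?N x (X l p)))"
      by (intro linear_at_sum linear_at_mult_left linear_at_nabla_J_at nabla_J_at_tangent frame_tangent y)
    then show "linear_at p (?B y)"
      by (rule linear_at_cong[THEN iffD1, rotated]) (simp add: inner y)
  qed
  then show ?thesis
    by (simp add: square_norm_nabla_J_def inner frame_tangent nabla_J_at_frame)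
qed

end

section \<open>The four-dimensional family\<close>

text \<open>Nested uses act as tables of components. The last branch catches the index 4, which is 0
  in the type \<open>4\<close>.\<close>

definition quad :: "'b \<Rightarrow> 'b \<Rightarrow> 'b \<Rightarrow> 'b \<Rightarrow> 4 \<Rightarrow> 'b" where
  "quad a b c d i = (if i = 1 then a else if i = 2 then b else if i = 3 then c else d)"

lemma quad_simps [simp]: "quad a b c d 1 = a" "quad a b c d 2 = b" "quad a b c d 3 = c" "quad a b c d 4 = d"
  by (simp_all add: quad_def)

definition opp :: "4 \<Rightarrow> 4" where
  "opp = quad 3 4 1 2"

lemma opp_simps [simp]: "opp 1 = 3" "opp 2 = 4" "opp 3 = 1" "opp 4 = 2"
  by (simp_all add: opp_def)

lemma opp_opp [simp]: "opp (opp i) = i"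
  using exhaust_4[of i] by auto

text \<open>Gram matrix of \<open>gt\<close>: \<open>gt(X i, X j) = g(X i, J (X j))\<close> is
  nonzero only when \<open>J\<close> carries \<open>X j\<close> to a multiple of \<open>X i\<close>,
  and the signs of \<open>g\<close> and \<open>J\<close> combine to -1 each time.\<close>

definition norden_matrix :: "real^4^4" where
  "norden_matrix = (\<chi> i j. if j = opp i then -1 else 0)"

lemma norden_matrix_nth: "norden_matrix $ i $ j = (if j = opp i then -1 else 0)"
  by (simp add: norden_matrix_def)

lemma sum_norden_matrix: "(\<Sum>m\<in>UNIV. f m * norden_matrix $ m $ k) = - f (opp k)"
proof -
  have "(\<Sum>m\<in>UNIV. f m * norden_matrix $ m $ k) = (\<Sum>m\<in>UNIV. if opp k = m then - f m else 0)"
    by (intro sum.cong) (auto simp: norden_matrix_def)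
  then show ?thesis by simp
qed

lemma double_sum_norden_matrix:
  "(\<Sum>i\<in>UNIV. \<Sum>j\<in>UNIV. norden_matrix $ i $ j * f i j) = - (\<Sum>i\<in>UNIV. f i (opp i))"
proof -
  have "(\<Sum>j\<in>UNIV. norden_matrix $ i $ j * f i j) = (\<Sum>j\<in>UNIV. if opp i = j then - f i j else 0)" for i
    by (intro sum.cong) (auto simp: norden_matrix_def)
  then show ?thesis by (simp add: sum_negf)
qed

lemma norden_matrix_square: "norden_matrix ** norden_matrix = mat 1"
  unfolding vec_eq_iff matrix_matrix_mult_def
  by (simp add: sum_norden_matrix) (auto simp: norden_matrix_def mat_def dest: arg_cong[of _ _ opp])

text \<open>The six prescribed brackets, completed by skew symmetry; the indices run as in
  \<open>frame_bracket\<close>.\<close>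

definition lie_struct :: "real \<Rightarrow> real \<Rightarrow> real \<Rightarrow> real \<Rightarrow> 4 \<Rightarrow> 4 \<Rightarrow> 4 \<Rightarrow> real" where
  "lie_struct l1 l2 l3 l4 = quad
     (quad (\<lambda>k. 0) (quad 0 0 l2 (- l1)) (quad 0 l2 0 l4) (quad 0 (- l1) (- l4) 0))
     (quad (quad 0 0 (- l2) l1) (\<lambda>k. 0) (quad (- l2) 0 0 (- l3)) (quad l1 0 l3 0))
     (quad (quad 0 (- l2) 0 (- l4)) (quad l2 0 0 l3) (\<lambda>k. 0) (quad (- l4) l3 0 0))
     (quad (quad 0 l1 l4 0) (quad (- l1) 0 (- l3) 0) (quad l4 (- l3) 0 0) (\<lambda>k. 0))"

definition lie_christoffel :: "real \<Rightarrow> real \<Rightarrow> real \<Rightarrow> real \<Rightarrow> 4 \<Rightarrow> 4 \<Rightarrow> 4 \<Rightarrow> real" where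
  "lie_christoffel l1 l2 l3 l4 = quad
     (quad (quad 0 l4 0 (- l2)) (quad (- l4/2) (- l3/2) l2 0) (quad 0 (l2/2) 0 (l4/2)) (quad (- l2/2) 0 (- l4) (l3/2)))
     (quad (quad (- l4/2) (- l3/2) 0 l1) (quad l3 0 (- l1) 0) (quad 0 (- l1/2) (l4/2) (- l3)) (quad (l1/2) 0 (l3/2) 0))
     (quad (quad 0 (- l2/2) 0 (- l4/2)) (quad l2 (- l1/2) (l4/2) 0) (quad 0 l4 0 (- l2)) (quad (- l4) 0 (l2/2) (l1/2)))
     (quad (quad (- l2/2) l1 0 (l3/2)) (quad (- l1/2) 0 (- l3/2) 0) (quad 0 (- l3) (l2/2) (l1/2)) (quad l3 0 (- l1) 0))"

definition lie_J :: "4 \<Rightarrow> 4 \<Rightarrow> real" where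
  "lie_J = quad (quad 0 0 1 0) (quad 0 0 0 1) (quad (-1) 0 0 0) (quad 0 (-1) 0 0)"

locale lie_norden_frame = constant_frame_J A X h norden_matrix norden_matrix nabla "lie_struct l1 l2 l3 l4" J lie_J
  for A :: "('a::{t2_space, second_countable_topology}, real^4) chart set"
    and X h nabla J and l1 l2 l3 l4 :: real
begin

lemma lower_eq: "lower i j k = - lie_struct l1 l2 l3 l4 i j (opp k)"
  unfolding lower_def by (rule sum_norden_matrix)

lemma christoffel_eq: "christoffel i j k = lie_christoffel l1 l2 l3 l4 i j k"
proof -
  have "\<forall>i j k. christoffel i j k = lie_christoffel l1 l2 l3 l4 i j k"
    unfolding forall_4 christoffel_def sum_norden_matrix lower_eq
    by (simp add: lie_struct_def lie_christoffel_def)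
  then show ?thesis by blast
qed

lemma riemann_lower_eq: "riemann_lower i j k l = - riemann i j k (opp l)"
  unfolding riemann_lower_def by (rule sum_norden_matrix)

definition lie_ricci :: "4 \<Rightarrow> 4 \<Rightarrow> real" where
  "lie_ricci = quad
    (quad (l4^2 - l3^2/2 - l2^2 - 2*l1^2) (- 3/2*l3*l4 - l1*l2) (l2*l4 + 3/2*l1*l3) (3/2*l2*l3 - l1*l4))
    (quad (- 3/2*l3*l4 - l1*l2) (l3^2 - l4^2/2 - 2*l2^2 - l1^2) (- l2*l3 + 3/2*l1*l4) (3/2*l2*l4 + l1*l3))
    (quad (l2*l4 + 3/2*l1*l3) (- l2*l3 + 3/2*l1*l4) (l2^2 - l4^2 - 2*l3^2 - l1^2/2) (- l3*l4 - 3/2*l1*l2))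
    (quad (3/2*l2*l3 - l1*l4) (3/2*l2*l4 + l1*l3) (- l3*l4 - 3/2*l1*l2) (l1^2 - 2*l4^2 - l3^2 - l2^2/2))"

lemma ricci_frame_eq: "ricci_frame j k = lie_ricci j k"
proof -
  have "\<forall>j k. ricci_frame j k = lie_ricci j k"
    unfolding ricci_frame_def double_sum_norden_matrix riemann_lower_eq opp_opp
    unfolding riemann_def christoffel_eq sum_4 forall_4
    by (simp add: lie_ricci_def lie_christoffel_def lie_struct_def field_simps power2_eq_square)
  then show ?thesis by blast
qed

text \<open>The trace meets only the Ricci entries (1,3) and (2,4) and their transposes. These two
  add up to 5/2 times \<open>l1 * l3 + l2 * l4\<close>, and the sign is that of
  \<open>norden_matrix\<close>.\<close>

lemma scalar_curvature_eq: "scalar_curvature A nabla h p = - 5 * (l1 * l3 + l2 * l4)"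
  unfolding scalar_curvature_frame double_sum_norden_matrix ricci_frame_eq
  unfolding sum_4 by (simp add: lie_ricci_def field_simps)

definition lie_nabla_J :: "4 \<Rightarrow> 4 \<Rightarrow> 4 \<Rightarrow> real" where
  "lie_nabla_J = quad
     (quad (quad 0 (- l2/2) 0 (- l4/2)) (quad (l2/2) 0 (- l4/2) l3) (quad 0 (- l4/2) 0 (l2/2)) (quad (- l4/2) l3 (- l2/2) 0))
     (quad (quad 0 (l1/2) l4 (- l3/2)) (quad (- l1/2) 0 (- l3/2) 0) (quad l4 (- l3/2) 0 (- l1/2)) (quad (- l3/2) 0 (l1/2) 0))
     (quad (quad 0 (l4/2) 0 (- l2/2)) (quad (- l4/2) 0 (- l2/2) l1) (quad 0 (- l2/2) 0 (- l4/2)) (quad (- l2/2) l1 (l4/2) 0))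
     (quad (quad 0 (- l3/2) l2 (- l1/2)) (quad (l3/2) 0 (- l1/2) 0) (quad l2 (- l1/2) 0 (l3/2)) (quad (- l1/2) 0 (- l3/2) 0))"

lemma nabla_J_frame_eq: "nabla_J_frame i j k = lie_nabla_J i j k"
proof -
  have "\<forall>i j k. nabla_J_frame i j k = lie_nabla_J i j k"
    unfolding forall_4 nabla_J_frame_def christoffel_eq sum_4
    by (simp add: lie_christoffel_def lie_J_def lie_nabla_J_def field_simps)
  then show ?thesis by blast
qed

lemma square_norm_nabla_J_eq: "square_norm_nabla_J A nabla J h p = - 8 * (l1 * l3 + l2 * l4)"
proof -
  have D: "(\<Sum>r\<in>UNIV. \<Sum>s\<in>UNIV. b r * d s * norden_matrix $ r $ s) = - (\<Sum>r\<in>UNIV. b r * d (opp r))"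
    for b d
    using double_sum_norden_matrix[of "\<lambda>r s. b r * d s"] by (simp add: mult.commute)
  show ?thesis
    unfolding square_norm_nabla_J_frame double_sum_norden_matrix D nabla_J_frame_eq
    unfolding sum_4 by (simp add: lie_nabla_J_def field_simps)
qed

text \<open>The factor 5/3 is minus one third of the scalar curvature divided by
  \<open>l1 * l3 + l2 * l4\<close>.\<close>

definition weyl_frame :: "4 \<Rightarrow> 4 \<Rightarrow> 4 \<Rightarrow> 4 \<Rightarrow> real" where
  "weyl_frame i j k l = - riemann i j k (opp l) - 1/2 * (
     norden_matrix $ j $ k * lie_ricci i l - norden_matrix $ i $ k * lie_ricci j l
     + lie_ricci j k * norden_matrix $ i $ l - lie_ricci i k * norden_matrix $ j $ l
     + 5/3 * (l1 * l3 + l2 * l4)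
       * (norden_matrix $ j $ k * norden_matrix $ i $ l - norden_matrix $ i $ k * norden_matrix $ j $ l))"

lemma weyl_at_frame: "weyl A nabla h p (X i p) (X j p) (X k p) (X l p) = weyl_frame i j k l"
  unfolding weyl_def psi1_def pi1_def curv_at_frame ricci_frame metric_frame
    ricci_frame_eq riemann_lower_eq scalar_curvature_eq weyl_frame_def
  by (simp add: field_simps)

lemma linear_at_weyl:
  assumes "x \<in> tangent_space A p" "y \<in> tangent_space A p" "z \<in> tangent_space A p"
  shows "linear_at p (\<lambda>v. weyl A nabla h p v x y z)"
    and "linear_at p (\<lambda>v. weyl A nabla h p x v y z)"
    and "linear_at p (\<lambda>v. weyl A nabla h p x y v z)"
    and "linear_at p (\<lambda>v. weyl A nabla h p x y z v)"
  unfolding weyl_def psi1_def pi1_def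
  by (intro linear_at_diff linear_at_add linear_at_mult_left linear_at_mult_right linear_at_curv_at
    linear_at_ricci linear_at_metric assms)+

text \<open>Multilinearity, used one argument at a time: frame vectors are replaced by arbitrary
  tangent vectors from the last argument to the first.\<close>

lemma weyl_eq_0_iff_frame:
  "(\<forall>x\<in>tangent_space A p. \<forall>y\<in>tangent_space A p. \<forall>z\<in>tangent_space A p. \<forall>u\<in>tangent_space A p.
      weyl A nabla h p x y z u = 0) \<longleftrightarrow> (\<forall>i j k l. weyl_frame i j k l = 0)"
proof
  assume *: "\<forall>i j k l. weyl_frame i j k l = 0"
  have 1: "weyl A nabla h p (X i p) (X j p) (X k p) u = 0" if "u \<in> tangent_space A p" for i j k u
    by (rule linear_at_eq_0[OF linear_at_weyl(4)]) (simp_all add: frame_tangent that weyl_at_frame *)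
  have 2: "weyl A nabla h p (X i p) (X j p) z u = 0"
    if "z \<in> tangent_space A p" "u \<in> tangent_space A p" for i j z u
    by (rule linear_at_eq_0[OF linear_at_weyl(3)]) (simp_all add: frame_tangent that 1)
  have 3: "weyl A nabla h p (X i p) y z u = 0"
    if "y \<in> tangent_space A p" "z \<in> tangent_space A p" "u \<in> tangent_space A p" for i y z u
    by (rule linear_at_eq_0[OF linear_at_weyl(2)]) (simp_all add: frame_tangent that 2)
  have "weyl A nabla h p x y z u = 0"
    if "x \<in> tangent_space A p" "y \<in> tangent_space A p" "z \<in> tangent_space A p" "u \<in> tangent_space A p"
    for x y z u
    by (rule linear_at_eq_0[OF linear_at_weyl(1)]) (simp_all add: that 3)
  then show "\<forall>x\<in>tangent_space A p. \<forall>y\<in>tangent_space A p. \<forall>z\<in>tangent_space A p. \<forall>u\<in>tangent_space A p.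
      weyl A nabla h p x y z u = 0" by blast
qed (use frame_tangent weyl_at_frame in metis)

lemma weyl_frame_eq_0_iff: "(\<forall>i j k l. weyl_frame i j k l = 0) \<longleftrightarrow> l1 * l3 + l2 * l4 = 0"
proof
  assume "\<forall>i j k l. weyl_frame i j k l = 0"
  \<comment> \<open>\<open>X 1\<close> and \<open>X 4\<close> span a totally null plane of
    \<open>gt\<close>, so all correction terms vanish and the component is a pure curvature
    component, equal to \<open>l1 * l3 + l2 * l4\<close>.\<close>
  then have "weyl_frame 1 4 1 4 = 0" by blast
  then show "l1 * l3 + l2 * l4 = 0"
    unfolding weyl_frame_def riemann_def christoffel_eq sum_4
    by (simp add: lie_ricci_def lie_christoffel_def lie_struct_def norden_matrix_nth field_simps)
next
  assume *: "l1 * l3 + l2 * l4 = 0"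
  have "weyl_frame i j k l = 0" for i j k l
    using exhaust_4[of i] exhaust_4[of j] exhaust_4[of k] exhaust_4[of l] *
    unfolding weyl_frame_def riemann_def christoffel_eq sum_4
    by (elim disjE; simp add: lie_ricci_def lie_christoffel_def lie_struct_def norden_matrix_nth
        field_simps power2_eq_square)
  then show "\<forall>i j k l. weyl_frame i j k l = 0" by blast
qed

end

theorem theorem3p8:
  fixes A :: "('a::{t2_space, second_countable_topology}, real^4) chart set"
    and G :: "'a monoid"
    and X :: "4 \<Rightarrow> 'a vfield"
    and J :: "'a endo_field"
    and g gt :: "'a form_field"
    and nabla :: "'a connection"
    and l1 l2 l3 l4 :: real
  assumes "lie_group A G"
    and "connected (UNIV :: 'a set)"
    and "lie_algebra_basis A G X"
    and "bracket (X 1) (X 3) = (\<lambda>p f. l2 * X 2 p f + l4 * X 4 p f)"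
    and "bracket (X 2) (X 4) = (\<lambda>p f. l1 * X 1 p f + l3 * X 3 p f)"
    and "bracket (X 2) (X 3) = (\<lambda>p f. - l2 * X 1 p f - l3 * X 4 p f)"
    and "bracket (X 3) (X 4) = (\<lambda>p f. - l4 * X 1 p f + l3 * X 2 p f)"
    and "bracket (X 4) (X 1) = (\<lambda>p f. l1 * X 2 p f + l4 * X 3 p f)"
    and "bracket (X 2) (X 1) = (\<lambda>p f. - l2 * X 3 p f + l1 * X 4 p f)"
    and "almost_complex A J"
    and "left_inv_endo A G J"
    and "\<And>p. J p (X 1 p) = X 3 p"
    and "\<And>p. J p (X 2 p) = X 4 p"
    and "\<And>p. J p (X 3 p) = (\<lambda>f. - X 1 p f)"
    and "\<And>p. J p (X 4 p) = (\<lambda>f. - X 2 p f)"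
    and "pseudo_riemannian A g"
    and "left_inv_form A G g"
    and "\<And>p. g p (X 1 p) (X 1 p) = 1"
    and "\<And>p. g p (X 2 p) (X 2 p) = 1"
    and "\<And>p. g p (X 3 p) (X 3 p) = -1"
    and "\<And>p. g p (X 4 p) (X 4 p) = -1"
    and "\<And>p i j. i \<noteq> j \<Longrightarrow> g p (X i p) (X j p) = 0"
    and "gt = associated_metric J g"
    and "levi_civita A gt nabla"
  shows "(isotropic_kaehler_norden A nabla J gt \<longleftrightarrow>
            (\<forall>p. \<forall>x\<in>tangent_space A p. \<forall>y\<in>tangent_space A p. \<forall>z\<in>tangent_space A p.
               \<forall>u\<in>tangent_space A p. weyl A nabla gt p x y z u = 0))
       \<and> ((\<forall>p. \<forall>x\<in>tangent_space A p. \<forall>y\<in>tangent_space A p. \<forall>z\<in>tangent_space A p.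
               \<forall>u\<in>tangent_space A p. weyl A nabla gt p x y z u = 0) \<longleftrightarrow>
            l1 * l3 + l2 * l4 = 0)
       \<and> (l1 * l3 + l2 * l4 = 0 \<longleftrightarrow> (\<forall>p. scalar_curvature A nabla gt p = 0))"
proof -
  have smooth: "smooth_manifold A" using assms(1) by (simp add: lie_group_def)
  interpret M: almost_complex_mfd A J
    using smooth \<open>almost_complex A J\<close> by unfold_locales
  have vf: "vector_field A (X i)" for i
    using assms(3) by (simp add: lie_algebra_basis_def left_inv_fields_def)
  let ?D = "(\<chi> i j. if i = j then quad 1 1 (-1) (-1) i else 0) :: real^4^4"
  have diag: "g p (X i p) (X i p) = quad 1 1 (-1) (-1) i" for i p
    using exhaust_4[of i] assms(18-21) by auto
  then have gD: "g p (X i p) (X j p) = ?D $ i $ j" for i j p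
    using assms(22)[of i j p] by (cases "i = j") simp_all
  have "?D ** ?D = mat 1"
    unfolding vec_eq_iff matrix_matrix_mult_def mat_def forall_4 by (simp add: sum_4)
  \<comment> \<open>The diagonal matrix of \<open>g\<close> is its own inverse. The frame calculus
    for \<open>g\<close> is wanted to extend identities from the frame to all tangent
    vectors.\<close>
  then interpret g: metric_frame A X g ?D ?D
    using vf \<open>pseudo_riemannian A g\<close> gD by unfold_locales
  have JX: "J p (X i p) = (\<lambda>f. \<Sum>k\<in>UNIV. lie_J i k * X k p f)" for i p
    using exhaust_4[of i] assms(12-15)[of p] by (auto simp: lie_J_def sum_4)
  have gJ: "g p u (J p (X j p)) = (\<Sum>k\<in>UNIV. lie_J j k * g p u (X k p))"
    if u: "u \<in> tangent_space A p" for p u j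
  proof -
    have "g p u (J p (X j p)) = g p (J p (X j p)) u"
      by (intro g.metric_sym u M.J_tangent g.frame_tangent)
    also have "\<dots> = (\<Sum>k\<in>UNIV. lie_J j k * g p (X k p) u)"
      unfolding JX by (rule g.metric_sum[OF u g.frame_tangent])
    finally show ?thesis using g.metric_sym[OF u g.frame_tangent] by simp
  qed
  have gt_frame: "gt p (X i p) (X j p) = norden_matrix $ i $ j" for i j p
    unfolding assms(23) associated_metric_def gJ[OF g.frame_tangent] gD
    using exhaust_4[of i] exhaust_4[of j]
    by (auto simp: sum_4 lie_J_def norden_matrix_nth)
  have linear_J: "g.linear_at p (\<lambda>v. g p (J p v) u)" if u: "u \<in> tangent_space A p" for p u
    unfolding g.linear_at_def
  proof
    fix v assume v: "v \<in> tangent_space A p"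
    have "J p v = J p (\<lambda>f. \<Sum>i\<in>UNIV. g.coord p v i * X i p f)"
      by (rule arg_cong[OF g.coord_expand[OF v]])
    also have "\<dots> = (\<lambda>f. \<Sum>i\<in>UNIV. g.coord p v i * J p (X i p) f)"
      by (rule M.J_sum[OF g.frame_tangent])
    finally have "J p v = (\<lambda>f. \<Sum>i\<in>UNIV. g.coord p v i * J p (X i p) f)" .
    then show "g p (J p v) u = (\<Sum>i\<in>UNIV. g.coord p v i * g p (J p (X i p)) u)"
      using g.metric_sum[OF u M.J_tangent[OF g.frame_tangent]] by simp
  qed
  have linear_J': "g.linear_at p (\<lambda>v. g p u (J p v))" if u: "u \<in> tangent_space A p" for p u
    using linear_J[OF u] g.metric_sym[OF M.J_tangent u]
    by (rule g.linear_at_cong[THEN iffD1, rotated])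
  \<comment> \<open>The Norden identity for \<open>g\<close> is verified on the frame and then
    spread by linearity, first in the left and then in the right argument; it is written as a
    vanishing sum to suit \<open>linear_at_eq_0\<close>.\<close>
  have anti_frame: "g p (J p (X i p)) (J p (X j p)) + g p (X i p) (X j p) = 0" for p i j
    unfolding gJ[OF M.J_tangent[OF g.frame_tangent]]
    unfolding JX g.metric_sum[OF g.frame_tangent g.frame_tangent] gD
    using exhaust_4[of i] exhaust_4[of j] by (auto simp: sum_4 lie_J_def)
  have "g p (J p v) (J p w) + g p v w = 0"
    if v: "v \<in> tangent_space A p" and w: "w \<in> tangent_space A p" for p v w
  proof -
    note T = g.frame_tangent M.J_tangent
    have "g p (J p v) (J p (X j p)) + g p v (X j p) = 0" for j
      using g.linear_at_add[OF linear_J g.linear_at_metric(1)] anti_frame v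
      by (rule g.linear_at_eq_0) (simp_all add: T)
    with g.linear_at_add[OF linear_J' g.linear_at_metric(2)] show ?thesis
      using w by (rule g.linear_at_eq_0) (simp_all add: T v)
  qed
  then have "norden_metric A J g"
    using assms(10,16) by (simp add: norden_metric_def eq_neg_iff_add_eq_0)
  then have norden: "norden_metric A J gt"
    unfolding assms(23) by (rule norden_metric_associated[OF smooth])
  have skew: "bracket (X i) (X j) = (\<lambda>p f. - bracket (X j) (X i) p f)" for i j
    by (simp add: bracket_def)
  have self: "bracket (X i) (X i) = (\<lambda>p f. 0)" for i
    by (simp add: bracket_def)
  have "bracket (X i) (X j) = (\<lambda>p f. \<Sum>k\<in>UNIV. lie_struct l1 l2 l3 l4 i j k * X k p f)" for i j
    using exhaust_4[of i] exhaust_4[of j] assms(4-9)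
      skew[of 3 1] skew[of 4 2] skew[of 3 2] skew[of 4 3] skew[of 1 4] skew[of 1 2] self
    by (elim disjE) (simp_all add: lie_struct_def sum_4 add.commute)
  then interpret lie_norden_frame A X gt nabla J l1 l2 l3 l4
    using vf norden gt_frame norden_matrix_square JX \<open>levi_civita A gt nabla\<close>
    by unfold_locales (simp_all add: norden_metric_def)
  \<comment> \<open>All three conditions now express the vanishing of nonzero multiples of the same
    number at every point, and none of these values depends on the point.\<close>
  have scale: "- 5 * r = 0 \<longleftrightarrow> r = 0" "- 8 * r = 0 \<longleftrightarrow> r = 0" for r :: real
    by simp_all
  show ?thesis
    unfolding isotropic_kaehler_norden_def weyl_eq_0_iff_frame weyl_frame_eq_0_iff
      square_norm_nabla_J_eq scalar_curvature_eq scale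
    using norden by blast
qed

end
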